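(* Let $T$ be a positive, densely defined closed operator in $H$ which is absolutely minimum attaining, not bounded, and one-to-one. Then there exists an unbounded (increasing) sequence $\{\lambda_n\}_{n\in\mathbb N}$ of eigenvalues of $T$ with corresponding eigenvectors $\{\phi_n\}_{n\in\mathbb N}$ such that (1) $D(T)=\{x\in H: \sum_{n=1}^{\infty}\lambda_n^2\,|\langle x,\phi_n\rangle|^2<\infty\}$ and $$Tx=\sum_{n=1}^\infty\lambda_n\langle x,\phi_n\rangle\phi_n\quad\text{for all } x\in D(T),$$ where the series converges in the strong operator topology (that is, in norm for each $x\in D(T)$); moreover, $T^{-1}$ is compact; (2) $\sigma(T)=\{\lambda_n:n\in\mathbb N\}=\sigma_p(T)$; (3) if $\mu\in\sigma_p(T)$, then $\mu$ is an eigenvalue of finite multiplicity; (4) $\overline{\operatorname{span}}\{\phi_n:n\in\mathbb N\}=H$.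
   Context: $H$ is an infinite dimensional complex Hilbert space. A densely defined closed operator $T$ in $H$ is positive if it is self-adjoint and $\langle Tx,x\rangle\ge 0$ for all $x\in D(T)$. For a closed subspace $M$ of $H$ with $D(T)\cap M\neq\{0\}$, put $m(T|_M)=\inf\{\|Tx\|: x\in D(T)\cap M,\ \|x\|=1\}$. $T$ is called absolutely minimum attaining if for every closed subspace $M$ of $H$ with $D(T)\cap M\ne\{0\}$ there is $x_0\in D(T)\cap M$ with $\|x_0\|=1$ and $\|Tx_0\|=m(T|_M)$. $\sigma(T)$ and $\sigma_p(T)$ denote the spectrum and the point spectrum (set of eigenvalues) of $T$. "Increasing" means $\lambda_n\le\lambda_{n+1}$ for all $n$ (eigenvalues may be repeated according to multiplicity). *)

theory Defs
  imports "HOL-Analysis.Analysis"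
begin

text \<open>
  Complex Hilbert spaces: Banach spaces whose norm comes from a complex inner product.
  The inner product is linear in its first argument.
\<close>

class complex_hilbert = banach +
  fixes scaleC :: "complex \<Rightarrow> 'a \<Rightarrow> 'a" (infixr "*\<^sub>C" 75)
    and cinner :: "'a \<Rightarrow> 'a \<Rightarrow> complex"
  assumes scaleC_add_right: "a *\<^sub>C (x + y) = a *\<^sub>C x + a *\<^sub>C y"
    and scaleC_add_left: "(a + b) *\<^sub>C x = a *\<^sub>C x + b *\<^sub>C x"
    and scaleC_scaleC: "a *\<^sub>C (b *\<^sub>C x) = (a * b) *\<^sub>C x"
    and scaleC_one: "1 *\<^sub>C x = x"
    and scaleR_scaleC: "r *\<^sub>R x = complex_of_real r *\<^sub>C x"
    and cinner_commute: "cinner x y = cnj (cinner y x)"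
    and cinner_add_left: "cinner (x + y) z = cinner x z + cinner y z"
    and cinner_scaleC_left: "cinner (a *\<^sub>C x) y = a * cinner x y"
    and cinner_self_nonneg: "cinner x x \<in> nonneg_Reals"
    and norm_eq_sqrt_cinner: "norm x = sqrt (Re (cinner x x))"

interpretation complex_vector: vector_space "scaleC :: complex \<Rightarrow> 'a \<Rightarrow> 'a::complex_hilbert"
  by unfold_locales
    (simp_all add: scaleC_add_right scaleC_add_left scaleC_scaleC scaleC_one)

abbreviation csubspace :: "'a::complex_hilbert set \<Rightarrow> bool" where
  "csubspace \<equiv> complex_vector.subspace"

abbreviation cspan :: "'a::complex_hilbert set \<Rightarrow> 'a set" where
  "cspan \<equiv> complex_vector.span"

definition finite_dimensional :: "'a::complex_hilbert set \<Rightarrow> bool" where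
  "finite_dimensional S \<longleftrightarrow> (\<exists>B. finite B \<and> cspan B = S)"

text \<open>
  An operator in \<open>H\<close> is given by its domain \<open>D\<close> and a function \<open>T\<close>; only the values of \<open>T\<close>
  on \<open>D\<close> are relevant.
\<close>

definition linear_operator :: "'a::complex_hilbert set \<Rightarrow> ('a \<Rightarrow> 'a) \<Rightarrow> bool" where
  "linear_operator D T \<longleftrightarrow> csubspace D \<and>
     (\<forall>x\<in>D. \<forall>y\<in>D. T (x + y) = T x + T y) \<and> (\<forall>a. \<forall>x\<in>D. T (a *\<^sub>C x) = a *\<^sub>C T x)"

definition densely_defined :: "'a::complex_hilbert set \<Rightarrow> bool" where
  "densely_defined D \<longleftrightarrow> closure D = UNIV"

definition operator_graph :: "'a::complex_hilbert set \<Rightarrow> ('a \<Rightarrow> 'a) \<Rightarrow> ('a \<times> 'a) set" where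
  "operator_graph D T = {(x, T x) | x. x \<in> D}"

definition closed_operator :: "'a::complex_hilbert set \<Rightarrow> ('a \<Rightarrow> 'a) \<Rightarrow> bool" where
  "closed_operator D T \<longleftrightarrow> linear_operator D T \<and> closed (operator_graph D T)"

definition bounded_operator :: "'a::complex_hilbert set \<Rightarrow> ('a \<Rightarrow> 'a) \<Rightarrow> bool" where
  "bounded_operator D T \<longleftrightarrow> linear_operator D T \<and> (\<exists>C. \<forall>x\<in>D. norm (T x) \<le> C * norm x)"

text \<open>
  The graph of the adjoint: \<open>y\<close> is in its domain iff there is \<open>z\<close> with
  \<open>\<langle>T x, y\<rangle> = \<langle>x, z\<rangle>\<close> for all \<open>x \<in> D\<close>, and then \<open>z\<close> is its value at \<open>y\<close>
  (unique when \<open>D\<close> is dense).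
\<close>

definition adjoint_graph :: "'a::complex_hilbert set \<Rightarrow> ('a \<Rightarrow> 'a) \<Rightarrow> ('a \<times> 'a) set" where
  "adjoint_graph D T = {(y, z). \<forall>x\<in>D. cinner (T x) y = cinner x z}"

definition self_adjoint :: "'a::complex_hilbert set \<Rightarrow> ('a \<Rightarrow> 'a) \<Rightarrow> bool" where
  "self_adjoint D T \<longleftrightarrow> adjoint_graph D T = operator_graph D T"

definition positive_operator :: "'a::complex_hilbert set \<Rightarrow> ('a \<Rightarrow> 'a) \<Rightarrow> bool" where
  "positive_operator D T \<longleftrightarrow> densely_defined D \<and> closed_operator D T \<and>
     self_adjoint D T \<and> (\<forall>x\<in>D. cinner (T x) x \<in> nonneg_Reals)"

definition min_modulus_on ::
  "'a::complex_hilbert set \<Rightarrow> ('a \<Rightarrow> 'a) \<Rightarrow> 'a set \<Rightarrow> real" where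
  "min_modulus_on D T M = Inf {norm (T x) | x. x \<in> D \<inter> M \<and> norm x = 1}"

definition absolutely_minimum_attaining ::
  "'a::complex_hilbert set \<Rightarrow> ('a \<Rightarrow> 'a) \<Rightarrow> bool" where
  "absolutely_minimum_attaining D T \<longleftrightarrow>
     (\<forall>M. csubspace M \<and> closed M \<and> D \<inter> M \<noteq> {0} \<longrightarrow>
        (\<exists>x0 \<in> D \<inter> M. norm x0 = 1 \<and> norm (T x0) = min_modulus_on D T M))"

definition resolvent_set :: "'a::complex_hilbert set \<Rightarrow> ('a \<Rightarrow> 'a) \<Rightarrow> complex set" where
  "resolvent_set D T = {\<mu>. bij_betw (\<lambda>x. T x - \<mu> *\<^sub>C x) D UNIV \<and>
     bounded_operator UNIV (inv_into D (\<lambda>x. T x - \<mu> *\<^sub>C x))}"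

definition spectrum :: "'a::complex_hilbert set \<Rightarrow> ('a \<Rightarrow> 'a) \<Rightarrow> complex set" where
  "spectrum D T = - resolvent_set D T"

definition eigenspace :: "'a::complex_hilbert set \<Rightarrow> ('a \<Rightarrow> 'a) \<Rightarrow> complex \<Rightarrow> 'a set" where
  "eigenspace D T \<mu> = {x \<in> D. T x = \<mu> *\<^sub>C x}"

definition eigenvector ::
  "'a::complex_hilbert set \<Rightarrow> ('a \<Rightarrow> 'a) \<Rightarrow> complex \<Rightarrow> 'a \<Rightarrow> bool" where
  "eigenvector D T \<mu> x \<longleftrightarrow> x \<in> eigenspace D T \<mu> \<and> x \<noteq> 0"

definition point_spectrum :: "'a::complex_hilbert set \<Rightarrow> ('a \<Rightarrow> 'a) \<Rightarrow> complex set" where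
  "point_spectrum D T = {\<mu>. \<exists>x. eigenvector D T \<mu> x}"

definition compact_operator :: "('a::complex_hilbert \<Rightarrow> 'a) \<Rightarrow> bool" where
  "compact_operator K \<longleftrightarrow> linear_operator UNIV K \<and>
     (\<forall>S. bounded S \<longrightarrow> compact (closure (K ` S)))"

end

theory Submission
  imports Defs
begin

text \<open>
  Take a maximal orthonormal set of eigenvectors. If it were not total, \<open>\<parallel>T x\<parallel>\<close> would attain its
  minimum on the unit sphere of the orthogonal complement, and a minimizer is a further eigenvector;
  so the eigenvectors form an orthonormal basis. Since \<open>T\<close> is unbounded, infinitely many of them
  have large eigenvalues. If infinitely many had eigenvalues below some \<open>C\<close>, pairing these with
  eigenvectors of eigenvalue at least \<open>C + 1\<close> would give a closed subspace on which \<open>\<parallel>T x\<parallel>\<close> does not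
  attain its minimum. Hence only finitely many eigenvalues lie below any bound, the basis can be
  enumerated with increasing eigenvalues tending to infinity, and \<open>T\<close> is the corresponding diagonal
  operator.
\<close>

section \<open>Orthonormal families in complex Hilbert spaces\<close>

text \<open>No spectral theorem is invoked; minimum attainment on well chosen closed subspaces takes
  its place. The obstacle is that \<open>D\<close> is only dense: a closed subspace may meet it in
  0, and then the hypothesis says nothing. The minimum over the whole space is positive by
  injectivity, so \<open>T\<close> is bounded below, and with self-adjointness it is onto. The
  everywhere defined inverse \<open>S\<close> maps the orthogonal complement of a set of
  eigenvectors into itself and into \<open>D\<close>, which supplies the nonzero domain vector. A
  maximal orthonormal set comes without order or size; hence the sums are unordered
  (\<open>has_sum\<close>), and countability appears only through the finiteness of the eigenvalue
  levels. The pairing is needed because infinitely many low eigenvectors alone (all with the same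
  eigenvalue, say) may well attain their minimum. Mixing in a high eigenvector tunes \<parallel>T
  v\<parallel> to prescribed values above \<open>C\<close>, which decrease strictly to a bound that
  is never reached.\<close>

lemma cinner_self: "cinner x x = complex_of_real ((norm x)\<^sup>2)"
  using cinner_self_nonneg[of x] norm_eq_sqrt_cinner[of x]
  by (auto simp: complex_nonneg_Reals_iff complex_eq_iff)

lemma cinner_add_right: "cinner x (y + z) = cinner x y + cinner x z"
  by (metis cinner_add_left cinner_commute complex_cnj_add)

lemma cinner_scaleC_right: "cinner x (a *\<^sub>C y) = cnj a * cinner x y"
  by (metis cinner_commute cinner_scaleC_left complex_cnj_mult)

lemma cinner_zero_left [simp]: "cinner 0 y = 0"
  using cinner_add_left[of 0 0 y] by simp

lemma cinner_zero_right [simp]: "cinner x 0 = 0"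
  using cinner_add_right[of x 0 0] by simp

lemma cinner_minus_left: "cinner (- x) y = - cinner x y"
  using cinner_add_left[of x "- x" y] by (simp add: add_eq_0_iff)

lemma cinner_minus_right: "cinner x (- y) = - cinner x y"
  using cinner_add_right[of x y "- y"] by (simp add: add_eq_0_iff)

lemma cinner_diff_left: "cinner (x - y) z = cinner x z - cinner y z"
  using cinner_add_left[of x "- y" z] by (simp add: cinner_minus_left)

lemma cinner_diff_right: "cinner x (y - z) = cinner x y - cinner x z"
  using cinner_add_right[of x y "- z"] by (simp add: cinner_minus_right)

lemma cinner_sum_left: "cinner (\<Sum>i\<in>I. f i) y = (\<Sum>i\<in>I. cinner (f i) y)"
  by (induction I rule: infinite_finite_induct) (auto simp: cinner_add_left)

lemma cinner_sum_right: "cinner x (\<Sum>i\<in>I. f i) = (\<Sum>i\<in>I. cinner x (f i))"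
  by (induction I rule: infinite_finite_induct) (auto simp: cinner_add_right)

lemma cinner_eq_zero_commute: "cinner x y = 0 \<longleftrightarrow> cinner y x = 0"
  by (metis cinner_commute complex_cnj_zero)

lemma cinner_self_eq_zero: "cinner x x = 0 \<longleftrightarrow> x = 0"
  by (simp add: cinner_self)

lemma norm_scaleC: "norm (a *\<^sub>C x) = cmod a * norm (x :: 'a::complex_hilbert)"
proof -
  have "complex_of_real ((norm (a *\<^sub>C x))\<^sup>2) = complex_of_real ((cmod a * norm x)\<^sup>2)"
    unfolding cinner_self[symmetric] cinner_scaleC_left cinner_scaleC_right
    by (simp add: cinner_self power_mult_distrib complex_norm_square
        del: of_real_power flip: mult.assoc)
  then have "(norm (a *\<^sub>C x))\<^sup>2 = (cmod a * norm x)\<^sup>2"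
    using of_real_eq_iff by blast
  then show ?thesis
    by (simp add: power2_eq_iff_nonneg)
qed

lemma norm_diff_square:
  "(norm (x - y))\<^sup>2 = (norm x)\<^sup>2 - 2 * Re (cinner x y) + (norm (y :: 'a::complex_hilbert))\<^sup>2"
proof -
  have "complex_of_real ((norm (x - y))\<^sup>2)
      = (norm x)\<^sup>2 - (cinner x y + cnj (cinner x y)) + (norm y)\<^sup>2"
    unfolding cinner_self[symmetric] cinner_diff_left cinner_diff_right
    using cinner_commute[of y x] by (simp add: cinner_self)
  then have "Re (complex_of_real ((norm (x - y))\<^sup>2))
      = Re ((norm x)\<^sup>2 - (cinner x y + cnj (cinner x y)) + (norm y)\<^sup>2)"
    by (rule arg_cong)
  then show ?thesis
    by (simp add: cinner_commute[of y x] del: of_real_power)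
qed

definition orthonormal_on :: "'i set \<Rightarrow> ('i \<Rightarrow> 'a::complex_hilbert) \<Rightarrow> bool" where
  "orthonormal_on I e \<longleftrightarrow> (\<forall>i\<in>I. \<forall>j\<in>I. cinner (e i) (e j) = (if i = j then 1 else 0))"

lemma orthonormal_onD:
  "orthonormal_on I e \<Longrightarrow> i \<in> I \<Longrightarrow> j \<in> I \<Longrightarrow> cinner (e i) (e j) = (if i = j then 1 else 0)"
  by (simp add: orthonormal_on_def)

lemma orthonormal_on_norm: "orthonormal_on I e \<Longrightarrow> i \<in> I \<Longrightarrow> norm (e i) = 1"
  using orthonormal_onD[of I e i i] by (simp add: norm_eq_sqrt_cinner)

lemma cinner_orthonormal_sum:
  assumes "orthonormal_on I e" "F \<subseteq> I" "finite F" "j \<in> I"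
  shows "cinner (\<Sum>i\<in>F. c i *\<^sub>C e i) (e j) = (if j \<in> F then c j else 0)"
proof -
  have "cinner (\<Sum>i\<in>F. c i *\<^sub>C e i) (e j) = (\<Sum>i\<in>F. if i = j then c i else 0)"
    unfolding cinner_sum_left cinner_scaleC_left
    using assms by (intro sum.cong) (auto simp: orthonormal_onD)
  then show ?thesis
    using assms(3) by simp
qed

lemma norm_orthonormal_sum:
  assumes "orthonormal_on I e" "F \<subseteq> I" "finite F"
  shows "(norm (\<Sum>i\<in>F. c i *\<^sub>C e i))\<^sup>2 = (\<Sum>i\<in>F. (cmod (c i))\<^sup>2)"
proof -
  have "complex_of_real ((norm (\<Sum>i\<in>F. c i *\<^sub>C e i))\<^sup>2)
      = (\<Sum>j\<in>F. cnj (c j) * cinner (\<Sum>i\<in>F. c i *\<^sub>C e i) (e j))"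
    unfolding cinner_self[symmetric] cinner_sum_right[where I = F] cinner_scaleC_right ..
  also have "\<dots> = (\<Sum>j\<in>F. complex_of_real ((cmod (c j))\<^sup>2))"
    using assms by (intro sum.cong refl)
      (auto simp: cinner_orthonormal_sum[OF assms subsetD[OF assms(2)]] complex_norm_square mult.commute simp del: of_real_power)
  finally show ?thesis
    by (simp only: of_real_sum[symmetric] of_real_eq_iff)
qed

lemma bessel_finite:
  assumes "orthonormal_on I e" "F \<subseteq> I" "finite F"
  shows "(\<Sum>i\<in>F. (cmod (cinner x (e i)))\<^sup>2) \<le> (norm x)\<^sup>2"
proof -
  let ?p = "\<Sum>i\<in>F. cinner x (e i) *\<^sub>C e i"
  have "cinner x ?p = (\<Sum>i\<in>F. complex_of_real ((cmod (cinner x (e i)))\<^sup>2))"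
    unfolding cinner_sum_right cinner_scaleC_right
    by (intro sum.cong refl) (simp add: complex_norm_square mult.commute del: of_real_power)
  then have "Re (cinner x ?p) = (\<Sum>i\<in>F. (cmod (cinner x (e i)))\<^sup>2)"
    by (simp del: of_real_power)
  then have "(norm (x - ?p))\<^sup>2 = (norm x)\<^sup>2 - (\<Sum>i\<in>F. (cmod (cinner x (e i)))\<^sup>2)"
    using norm_diff_square[of x ?p] norm_orthonormal_sum[OF assms, of "\<lambda>i. cinner x (e i)"]
    by simp
  then show ?thesis
    by (smt (verit) zero_le_power2)
qed

text \<open>Bessel's inequality for the one-element family consisting of the normalized
  \<open>y\<close>.\<close>

lemma cauchy_schwarz: "cmod (cinner x y) \<le> norm x * norm (y :: 'a::complex_hilbert)"
proof (cases "y = 0")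
  case False
  define u where "u = complex_of_real (1 / norm y) *\<^sub>C y"
  have "orthonormal_on {()} (\<lambda>_. u)"
    using False by (simp add: orthonormal_on_def u_def cinner_scaleC_left cinner_scaleC_right
        cinner_self norm_scaleC norm_divide)
  from bessel_finite[OF this order.refl, of x] have "cmod (cinner x u) \<le> norm x"
    by (simp add: power2_le_iff_abs_le)
  then show ?thesis
    using False by (simp add: u_def cinner_scaleC_right norm_divide field_simps)
qed simp

section \<open>Convergence of orthonormal series and Fourier coefficients\<close>

lemma bounded_linear_cinner_left: "bounded_linear (\<lambda>x. cinner x (y :: 'a::complex_hilbert))"
  by (rule bounded_linear_intro[where K = "norm y"])
    (auto simp: cinner_add_left scaleR_scaleC cinner_scaleC_left scaleR_conv_of_real
      intro: cauchy_schwarz)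

lemma bounded_linear_scaleC_left: "bounded_linear (\<lambda>a. a *\<^sub>C (x :: 'a::complex_hilbert))"
  by (rule bounded_linear_intro[where K = "norm x"])
    (auto simp: scaleC_add_left scaleR_scaleC scaleC_scaleC norm_scaleC scaleR_conv_of_real)

text \<open>By Pythagoras the squared norm of a block of the series is the corresponding block of
  the square sum, so the partial sums form a Cauchy filter and completeness applies.\<close>

lemma square_summable_orthonormal:
  fixes e :: "'i \<Rightarrow> 'a::complex_hilbert"
  assumes "orthonormal_on I e" "(\<lambda>i. (cmod (c i))\<^sup>2) summable_on I"
  shows "(\<lambda>i. c i *\<^sub>C e i) summable_on I"
proof -
  let ?f = "\<lambda>i. c i *\<^sub>C e i" and ?g = "\<lambda>i. (cmod (c i))\<^sup>2"
  obtain L where L: "(?g has_sum L) I"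
    using assms(2) by (auto simp: summable_on_def)
  have "\<exists>P. eventually P (finite_subsets_at_top I) \<and>
      (\<forall>F F'. P F \<and> P F' \<longrightarrow> dist (sum ?f F) (sum ?f F') < r)" if "r > 0" for r
  proof -
    \<comment> \<open>Every finite sum over a superset of \<open>F0\<close> will lie within r/3 of
      the sum over \<open>F0\<close>, hence any two of them within 2r/3 < r.\<close>
    obtain F0 where F0: "finite F0" "F0 \<subseteq> I" "dist (sum ?g F0) L \<le> (r/3)\<^sup>2"
      using has_sum_finite_approximation[OF L, of "(r/3)\<^sup>2"] \<open>r > 0\<close> by auto
    define P where "P F \<longleftrightarrow> finite F \<and> F0 \<subseteq> F \<and> F \<subseteq> I" for F
    have "eventually P (finite_subsets_at_top I)"
      unfolding P_def eventually_finite_subsets_at_top using F0 by blast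
    moreover have *: "norm (sum ?f F - sum ?f F0) \<le> r/3" if "P F" for F
    proof -
      have F: "finite F" "F0 \<subseteq> F" "F \<subseteq> I"
        using that by (auto simp: P_def)
      have "(norm (sum ?f F - sum ?f F0))\<^sup>2 = (norm (sum ?f (F - F0)))\<^sup>2"
        using F by (simp add: sum_diff)
      also have "\<dots> = sum ?g (F - F0)"
        using F by (intro norm_orthonormal_sum[OF assms(1)]) auto
      also have "\<dots> = sum ?g F - sum ?g F0"
        using F by (simp add: sum_diff)
      also have "\<dots> \<le> L - sum ?g F0"
        using finite_sum_le_has_sum[OF L F(1,3)] by simp
      also have "\<dots> \<le> (r/3)\<^sup>2"
        using F0(3) by (auto simp: dist_real_def)
      finally show ?thesis
        by (rule power2_le_imp_le) (use \<open>r > 0\<close> in simp)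
    qed
    have "dist (sum ?f F) (sum ?f F') < r" if "P F \<and> P F'" for F F'
    proof -
      have "dist (sum ?f F) (sum ?f F') \<le> dist (sum ?f F) (sum ?f F0) + dist (sum ?f F') (sum ?f F0)"
        by (rule dist_triangle2)
      then show ?thesis
        using *[of F] *[of F'] that \<open>r > 0\<close> by (simp add: dist_norm)
    qed
    ultimately show ?thesis
      by blast
  qed
  then have "cauchy_filter (filtermap (sum ?f) (finite_subsets_at_top I))"
    by (simp add: cauchy_filter_metric_filtermap)
  then obtain y where "(sum ?f \<longlongrightarrow> y) (finite_subsets_at_top I)"
    using cauchy_filter_complete_converges[OF _ complete_UNIV, of "filtermap (sum ?f) (finite_subsets_at_top I)"]
    by (auto simp: filterlim_def filtermap_bot_iff)
  then show ?thesis
    by (auto simp: summable_on_def has_sum_def)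
qed

lemma cinner_has_sum_left:
  "(f has_sum x) I \<Longrightarrow> ((\<lambda>i. cinner (f i) y) has_sum cinner x (y :: 'a::complex_hilbert)) I"
  by (drule has_sum_bounded_linear[OF bounded_linear_cinner_left[of y]]) (simp add: o_def)

lemma orthonormal_coefficient:
  assumes "orthonormal_on I e" "((\<lambda>i. c i *\<^sub>C e i) has_sum x) I" "j \<in> I"
  shows "cinner x (e j) = c j"
proof -
  have "((\<lambda>i. cinner (c i *\<^sub>C e i) (e j)) has_sum cinner x (e j)) I"
    by (rule cinner_has_sum_left[OF assms(2)])
  moreover have "((\<lambda>i. cinner (c i *\<^sub>C e i) (e j)) has_sum c j) I \<longleftrightarrow> ((\<lambda>i. c i) has_sum c j) {j}"
    using assms(1,3) by (intro has_sum_cong_neutral) (auto simp: cinner_scaleC_left orthonormal_onD)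
  ultimately show ?thesis
    using has_sum_finite[of "{j}" c] by (auto intro: has_sum_unique)
qed

lemma bessel_summable:
  assumes "orthonormal_on I e"
  shows "(\<lambda>i. (cmod (cinner x (e i)))\<^sup>2) summable_on I"
  by (rule nonneg_bdd_above_summable_on)
    (auto intro!: bdd_aboveI2[where M = "(norm x)\<^sup>2"] bessel_finite[OF assms])

lemma orthogonal_has_sum:
  assumes "(f has_sum p) I" "\<And>i. i \<in> I \<Longrightarrow> cinner (f i) z = 0"
  shows "cinner p z = 0"
proof -
  have "((\<lambda>i. cinner (f i) z) has_sum 0) I"
    using assms(2) by (simp add: has_sum_0)
  then show ?thesis
    using cinner_has_sum_left[OF assms(1)] has_sum_unique by blast
qed

lemma orthonormal_projection:
  assumes "orthonormal_on I e"
  obtains p where "((\<lambda>i. cinner x (e i) *\<^sub>C e i) has_sum p) I"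
    and "\<And>i. i \<in> I \<Longrightarrow> cinner (x - p) (e i) = 0"
    and "cinner (x - p) p = 0"
proof -
  obtain p where p: "((\<lambda>i. cinner x (e i) *\<^sub>C e i) has_sum p) I"
    using square_summable_orthonormal[OF assms bessel_summable[OF assms]]
    by (auto simp: summable_on_def)
  have 0: "cinner (x - p) (e i) = 0" if "i \<in> I" for i
    using orthonormal_coefficient[OF assms p that] by (simp add: cinner_diff_left)
  then have "cinner p (x - p) = 0"
    by (intro orthogonal_has_sum[OF p]) (simp add: cinner_scaleC_left cinner_eq_zero_commute)
  with p 0 that show ?thesis
    using cinner_eq_zero_commute by blast
qed

text \<open>The second hypothesis puts \<open>x\<close> in the double orthogonal complement of the
  family. Phrasing it for a single \<open>x\<close> covers total families as well as vectors in the
  closed span of a family that is not total. The residual of the projection is orthogonal to the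
  family, hence to \<open>x\<close> and to the projection, hence to itself.\<close>

lemma orthonormal_expansion:
  assumes "orthonormal_on I e" "\<And>y. (\<And>i. i \<in> I \<Longrightarrow> cinner y (e i) = 0) \<Longrightarrow> cinner y x = 0"
  shows "((\<lambda>i. cinner x (e i) *\<^sub>C e i) has_sum x) I"
proof -
  obtain p where p: "((\<lambda>i. cinner x (e i) *\<^sub>C e i) has_sum p) I"
    "\<And>i. i \<in> I \<Longrightarrow> cinner (x - p) (e i) = 0" "cinner (x - p) p = 0"
    using orthonormal_projection[OF assms(1)] by blast
  then have "cinner (x - p) (x - p) = 0"
    using assms(2)[of "x - p"] by (simp add: cinner_diff_right)
  then show ?thesis
    using p(1) by (simp add: cinner_self_eq_zero)
qed

lemma orthonormal_norm_has_sum: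
  assumes "orthonormal_on I e" "((\<lambda>i. c i *\<^sub>C e i) has_sum x) I"
  shows "((\<lambda>i. (cmod (c i))\<^sup>2) has_sum (norm x)\<^sup>2) I"
proof -
  have "((\<lambda>i. cinner (c i *\<^sub>C e i) x) has_sum cinner x x) I"
    by (rule cinner_has_sum_left[OF assms(2)])
  moreover have "cinner (c i *\<^sub>C e i) x = complex_of_real ((cmod (c i))\<^sup>2)" if "i \<in> I" for i
    using orthonormal_coefficient[OF assms that] cinner_commute[of "e i" x]
    by (simp add: cinner_scaleC_left complex_norm_square del: of_real_power)
  ultimately have "((\<lambda>i. complex_of_real ((cmod (c i))\<^sup>2)) has_sum complex_of_real ((norm x)\<^sup>2)) I"
    unfolding cinner_self by (simp cong: has_sum_cong del: of_real_power)
  then show ?thesis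
    using has_sum_Re by fastforce
qed

text \<open>Zorn's lemma relative to an arbitrary set \<open>A\<close>, which is later a closed
  subspace or the set of unit eigenvectors. The vectors index themselves, so the family is the
  identity map on \<open>B\<close>.\<close>

lemma exists_maximal_orthonormal:
  obtains B where "B \<subseteq> A" "orthonormal_on B (\<lambda>x :: 'a::complex_hilbert. x)"
    "\<And>x. x \<in> A \<Longrightarrow> norm x = 1 \<Longrightarrow> \<exists>b\<in>B. cinner x b \<noteq> 0"
proof -
  let ?P = "{B. B \<subseteq> A \<and> orthonormal_on B (\<lambda>x :: 'a. x)}"
  have "\<exists>M\<in>?P. \<forall>X\<in>?P. M \<subseteq> X \<longrightarrow> X = M"
  proof (rule subset_Zorn')
    fix C assume C: "subset.chain ?P C"
    have "cinner x y = (if x = y then 1 else 0)" if xy: "x \<in> \<Union>C" "y \<in> \<Union>C" for x y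
    proof -
      obtain Y Z where "Y \<in> C" "x \<in> Y" "Z \<in> C" "y \<in> Z"
        using xy by blast
      moreover from this have "Y \<subseteq> Z \<or> Z \<subseteq> Y"
        using subset_chain_def[of ?P C] C by blast
      ultimately obtain X where "X \<in> C" "x \<in> X" "y \<in> X"
        by blast
      moreover have "orthonormal_on X (\<lambda>x. x)"
        using C \<open>X \<in> C\<close> unfolding subset.chain_def by blast
      ultimately show ?thesis
        by (simp add: orthonormal_on_def)
    qed
    then show "\<Union>C \<in> ?P"
      using C unfolding subset.chain_def by (auto simp: orthonormal_on_def)
  qed
  then obtain B where BP: "B \<in> ?P" and maxP: "\<forall>X\<in>?P. B \<subseteq> X \<longrightarrow> X = B" ..
  from BP have B: "B \<subseteq> A" "orthonormal_on B (\<lambda>x. x)"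
    by auto
  have max: "X = B" if "X \<subseteq> A" "orthonormal_on X (\<lambda>x. x)" "B \<subseteq> X" for X
    using maxP that by simp
  have "\<exists>b\<in>B. cinner x b \<noteq> 0" if "x \<in> A" "norm x = 1" for x
  proof (rule ccontr)
    assume "\<not> (\<exists>b\<in>B. cinner x b \<noteq> 0)"
    then have "orthonormal_on (insert x B) (\<lambda>x. x)"
      using B(2) that unfolding orthonormal_on_def
      by (auto simp: cinner_self cinner_eq_zero_commute[of _ x])
    with max[of "insert x B"] that B(1) have "x \<in> B"
      by blast
    with \<open>\<not> (\<exists>b\<in>B. cinner x b \<noteq> 0)\<close> that show False
      by (auto simp: cinner_self)
  qed
  with B that show ?thesis
    by blast
qed

lemma orthonormal_basis_expansion:
  assumes "orthonormal_on I e" "\<And>y. (\<And>i. i \<in> I \<Longrightarrow> cinner y (e i) = 0) \<Longrightarrow> y = 0"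
  shows "((\<lambda>i. cinner x (e i) *\<^sub>C e i) has_sum x) I"
  using assms(2) by (intro orthonormal_expansion[OF assms(1)]) force

text \<open>The projection theorem in disguise: project \<open>y\<close> onto \<open>R\<close> along
  a maximal orthonormal subset of \<open>R\<close>; the residual is orthogonal to all of
  \<open>R\<close> and so vanishes.\<close>

lemma closed_subspace_eq_UNIV:
  fixes R :: "'a::complex_hilbert set"
  assumes "csubspace R" "closed R" "\<And>y. (\<And>x. x \<in> R \<Longrightarrow> cinner x y = 0) \<Longrightarrow> y = 0"
  shows "R = UNIV"
proof -
  obtain B where B: "B \<subseteq> R" "orthonormal_on B (\<lambda>x :: 'a. x)"
    "\<And>x. x \<in> R \<Longrightarrow> norm x = 1 \<Longrightarrow> \<exists>b\<in>B. cinner x b \<noteq> 0"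
    using exists_maximal_orthonormal by metis
  have R0: "x = 0" if "x \<in> R" "\<And>b. b \<in> B \<Longrightarrow> cinner x b = 0" for x
  proof (rule ccontr)
    assume "x \<noteq> 0"
    let ?u = "complex_of_real (1 / norm x) *\<^sub>C x"
    have "?u \<in> R"
      using assms(1) that(1) by (rule complex_vector.subspace_scale)
    moreover have "norm ?u = 1"
      using \<open>x \<noteq> 0\<close> by (simp add: norm_scaleC norm_divide)
    ultimately show False
      using B(3)[of ?u] that(2) by (auto simp: cinner_scaleC_left)
  qed
  have inR: "p \<in> R" if "((\<lambda>b. c b *\<^sub>C b) has_sum p) B" for c p
  proof (rule Lim_in_closed_set[OF assms(2)])
    show "(sum (\<lambda>b. c b *\<^sub>C b) \<longlongrightarrow> p) (finite_subsets_at_top B)"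
      using that by (simp add: has_sum_def)
    have "sum (\<lambda>b. c b *\<^sub>C b) F \<in> R" if "F \<subseteq> B" for F
      using that B(1) assms(1)
      by (intro complex_vector.subspace_sum complex_vector.subspace_scale) auto
    then show "\<forall>\<^sub>F F in finite_subsets_at_top B. sum (\<lambda>b. c b *\<^sub>C b) F \<in> R"
      by (intro eventually_finite_subsets_at_top_weakI)
  qed auto
  \<comment> \<open>A vector of \<open>R\<close> equals its own Fourier series over
    \<open>B\<close>, so orthogonality to \<open>B\<close> spreads to \<open>R\<close>.\<close>
  have orth: "cinner r z = 0" if "r \<in> R" "\<And>b. b \<in> B \<Longrightarrow> cinner z b = 0" for r z
  proof -
    obtain p where p: "((\<lambda>b. cinner r b *\<^sub>C b) has_sum p) B"
      "\<And>b. b \<in> B \<Longrightarrow> cinner (r - p) b = 0"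
      using orthonormal_projection[OF B(2)] by blast
    have "r - p \<in> R"
      using assms(1) that(1) inR[OF p(1)] by (rule complex_vector.subspace_diff)
    then have "r = p"
      using R0[of "r - p"] p(2) by simp
    moreover have "cinner p z = 0"
      using that(2) by (intro orthogonal_has_sum[OF p(1)])
        (simp add: cinner_scaleC_left cinner_eq_zero_commute)
    ultimately show ?thesis
      by simp
  qed
  have "y \<in> R" for y
  proof -
    obtain p where p: "((\<lambda>b. cinner y b *\<^sub>C b) has_sum p) B"
      "\<And>b. b \<in> B \<Longrightarrow> cinner (y - p) b = 0"
      using orthonormal_projection[OF B(2)] by blast
    have "y - p = 0"
      by (rule assms(3), rule orth) (use p(2) in auto)
    then show ?thesis
      using inR[OF p(1)] by simp
  qed
  then show ?thesis
    by blast
qed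

lemma csubspace_orthogonal: "csubspace {x. \<forall>y\<in>A. cinner x y = 0}"
  by (auto simp: complex_vector.subspace_def cinner_add_left cinner_scaleC_left)

lemma closed_orthogonal: "closed {x :: 'a::complex_hilbert. \<forall>y\<in>A. cinner x y = 0}"
proof -
  have "{x. \<forall>y\<in>A. cinner x y = 0} = (\<Inter>y\<in>A. {x. cinner x y = 0})"
    by auto
  moreover have "closed {x. cinner x y = 0}" for y :: 'a
    by (intro closed_Collect_eq linear_continuous_on bounded_linear_cinner_left continuous_on_const)
  ultimately show ?thesis
    by auto
qed

section \<open>Positive absolutely minimum attaining operators\<close>

locale positive_am_operator =
  fixes D :: "'a::complex_hilbert set" and T :: "'a \<Rightarrow> 'a"
  assumes pos: "positive_operator D T"
    and am: "absolutely_minimum_attaining D T"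
    and inj: "inj_on T D"
    and unbounded: "\<not> bounded_operator D T"
begin

lemma linear_T: "linear_operator D T"
  using pos by (simp add: positive_operator_def closed_operator_def)

lemma csubspace_D: "csubspace D"
  using linear_T by (simp add: linear_operator_def)

lemma zero_in_D [simp]: "0 \<in> D"
  using csubspace_D by (rule complex_vector.subspace_0)

lemma add_in_D: "x \<in> D \<Longrightarrow> y \<in> D \<Longrightarrow> x + y \<in> D"
  using csubspace_D by (rule complex_vector.subspace_add)

lemma diff_in_D: "x \<in> D \<Longrightarrow> y \<in> D \<Longrightarrow> x - y \<in> D"
  using csubspace_D by (rule complex_vector.subspace_diff)

lemma scaleC_in_D: "x \<in> D \<Longrightarrow> a *\<^sub>C x \<in> D"
  using csubspace_D by (rule complex_vector.subspace_scale)

lemma T_add: "x \<in> D \<Longrightarrow> y \<in> D \<Longrightarrow> T (x + y) = T x + T y"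
  using linear_T by (simp add: linear_operator_def)

lemma T_scaleC: "x \<in> D \<Longrightarrow> T (a *\<^sub>C x) = a *\<^sub>C T x"
  using linear_T by (simp add: linear_operator_def)

lemma T_zero [simp]: "T 0 = 0"
  using T_scaleC[of 0 0] by simp

lemma T_diff: "x \<in> D \<Longrightarrow> y \<in> D \<Longrightarrow> T (x - y) = T x - T y"
  using T_add[of "x - y" y] diff_in_D by simp

lemma T_eq_zero: "x \<in> D \<Longrightarrow> T x = 0 \<Longrightarrow> x = 0"
  using inj_onD[OF inj, of x 0] by simp

lemma T_symmetric:
  assumes "x \<in> D" "y \<in> D"
  shows "cinner (T x) y = cinner x (T y)"
proof -
  have "(y, T y) \<in> adjoint_graph D T"
    using pos assms(2) unfolding positive_operator_def self_adjoint_def operator_graph_def by blast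
  then show ?thesis
    using assms(1) by (simp add: adjoint_graph_def)
qed

text \<open>This is the inclusion of the adjoint in \<open>T\<close>. Its strength is that
  membership in \<open>D\<close> is a conclusion.\<close>

lemma T_self_adjoint:
  assumes "\<And>x. x \<in> D \<Longrightarrow> cinner (T x) y = cinner x z"
  shows "y \<in> D" "T y = z"
proof -
  have "(y, z) \<in> adjoint_graph D T"
    using assms by (simp add: adjoint_graph_def)
  then have "(y, z) \<in> operator_graph D T"
    using pos unfolding positive_operator_def self_adjoint_def by blast
  then show "y \<in> D" "T y = z"
    by (auto simp: operator_graph_def)
qed

section \<open>Minimum attainment, the lower bound and surjectivity\<close>

lemma T_unbounded: "\<exists>x\<in>D. norm (T x) > C * norm x"
  using unbounded linear_T by (auto simp: bounded_operator_def not_le)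

text \<open>Homogeneous form of the hypothesis: the infimum over unit vectors becomes an inequality
  for all vectors of \<open>D \<inter> M\<close>, so later arguments need not normalize.\<close>

lemma minimum_attained:
  assumes "csubspace M" "closed M" "D \<inter> M \<noteq> {0}"
  obtains x0 where "x0 \<in> D" "x0 \<in> M" "norm x0 = 1"
    "\<And>x. x \<in> D \<Longrightarrow> x \<in> M \<Longrightarrow> norm (T x0) * norm x \<le> norm (T x)"
proof -
  obtain x0 where x0: "x0 \<in> D" "x0 \<in> M" "norm x0 = 1" "norm (T x0) = min_modulus_on D T M"
    using am assms unfolding absolutely_minimum_attaining_def by auto
  have "norm (T x0) * norm x \<le> norm (T x)" if "x \<in> D" "x \<in> M" for x
  proof (cases "x = 0")
    case False
    let ?u = "complex_of_real (1 / norm x) *\<^sub>C x"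
    have "?u \<in> D \<inter> M" "norm ?u = 1"
      using that assms(1) False
      by (auto simp: norm_scaleC norm_divide scaleC_in_D intro: complex_vector.subspace_scale)
    then have "norm (T ?u) \<in> {norm (T x) | x. x \<in> D \<inter> M \<and> norm x = 1}"
      by blast
    moreover have "bdd_below {norm (T x) | x. x \<in> D \<inter> M \<and> norm x = 1}"
      by (intro bdd_belowI[of _ 0]) auto
    ultimately have "norm (T x0) \<le> norm (T ?u)"
      unfolding x0(4) min_modulus_on_def by (rule cInf_lower)
    also have "\<dots> = norm (T x) / norm x"
      using that by (simp add: T_scaleC norm_scaleC norm_divide)
    finally show ?thesis
      using False by (simp add: field_simps)
  qed simp
  with x0 that show ?thesis
    by blast
qed

lemma bounded_below: obtains m where "m > 0" "\<And>x. x \<in> D \<Longrightarrow> m * norm x \<le> norm (T x)"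
proof -
  have "D \<inter> UNIV \<noteq> {0}"
    \<comment> \<open>With constant 0, unboundedness yields a domain vector with nonzero image,
      which is therefore nonzero.\<close>
    using T_unbounded[of 0] by auto
  then obtain x0 where "x0 \<in> D" "norm x0 = 1" "\<And>x. x \<in> D \<Longrightarrow> norm (T x0) * norm x \<le> norm (T x)"
    using minimum_attained[of UNIV] by auto
  with that[of "norm (T x0)"] T_eq_zero[of x0] show ?thesis
    by fastforce
qed

text \<open>The range is closed by the lower bound and the closed graph. A vector orthogonal to it
  lies in \<open>D\<close> and is killed by \<open>T\<close> (self-adjointness), so it is 0 by
  injectivity.\<close>

lemma T_surj: "T ` D = UNIV"
proof (rule closed_subspace_eq_UNIV)
  show "csubspace (T ` D)"
    unfolding complex_vector.subspace_def
  proof (intro conjI ballI allI)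
    show "0 \<in> T ` D"
      by (rule image_eqI[of _ _ 0]) auto
  next
    fix y z assume "y \<in> T ` D" "z \<in> T ` D"
    then obtain u v where "u \<in> D" "v \<in> D" "y = T u" "z = T v"
      by blast
    then show "y + z \<in> T ` D"
      by (intro image_eqI[of _ _ "u + v"]) (auto simp: T_add add_in_D)
  next
    fix c y assume "y \<in> T ` D"
    then obtain u where "u \<in> D" "y = T u"
      by blast
    then show "c *\<^sub>C y \<in> T ` D"
      by (intro image_eqI[of _ _ "c *\<^sub>C u"]) (auto simp: T_scaleC scaleC_in_D)
  qed
  show "closed (T ` D)"
    unfolding closed_sequential_limits
  proof (intro allI impI, elim conjE)
    fix y l assume y: "\<forall>n. y n \<in> T ` D" "y \<longlonglongrightarrow> l"
    from y(1) have "\<forall>n. \<exists>u. u \<in> D \<and> y n = T u"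
      by blast
    from choice[OF this] obtain x where x: "\<And>n. x n \<in> D" "\<And>n. y n = T (x n)"
      by blast
    obtain m where m: "m > 0" "\<And>x. x \<in> D \<Longrightarrow> m * norm x \<le> norm (T x)"
      using bounded_below by blast
    have "Cauchy x"
    proof (rule metric_CauchyI)
      fix r :: real assume "r > 0"
      then obtain N where N: "\<And>i j. i \<ge> N \<Longrightarrow> j \<ge> N \<Longrightarrow> dist (y i) (y j) < m * r"
        using metric_CauchyD[OF LIMSEQ_imp_Cauchy[OF y(2)], of "m * r"] m(1) by auto
      have "dist (x i) (x j) < r" if "i \<ge> N" "j \<ge> N" for i j
      proof -
        have "m * dist (x i) (x j) \<le> dist (y i) (y j)"
          using m(2)[of "x i - x j"] x by (simp add: dist_norm T_diff diff_in_D)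
        then have "m * dist (x i) (x j) < m * r"
          using N[OF that] by simp
        then show ?thesis
          using m(1) by simp
      qed
      then show "\<exists>N. \<forall>i\<ge>N. \<forall>j\<ge>N. dist (x i) (x j) < r"
        by blast
    qed
    then obtain z where "x \<longlonglongrightarrow> z"
      using Cauchy_convergent convergent_def by blast
    then have "(\<lambda>n. (x n, y n)) \<longlonglongrightarrow> (z, l)"
      using y(2) by (rule tendsto_Pair)
    moreover have "(x n, y n) \<in> operator_graph D T" for n
      using x by (auto simp: operator_graph_def)
    moreover have "closed (operator_graph D T)"
      using pos by (simp add: positive_operator_def closed_operator_def)
    ultimately have "(z, l) \<in> operator_graph D T"
      using closed_sequentially[of "operator_graph D T" "\<lambda>n. (x n, y n)"] by simp
    then show "l \<in> T ` D"
      by (auto simp: operator_graph_def)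
  qed
  fix y assume "\<And>x. x \<in> T ` D \<Longrightarrow> cinner x y = 0"
  then have "y \<in> D" "T y = 0"
    using T_self_adjoint[of y 0] by auto
  then show "y = 0"
    by (rule T_eq_zero)
qed

abbreviation S :: "'a \<Rightarrow> 'a" where "S \<equiv> inv_into D T"

lemma S_in_D [simp]: "S y \<in> D"
  by (simp add: T_surj inv_into_into)

lemma T_S [simp]: "T (S y) = y"
  by (simp add: T_surj f_inv_into_f)

lemma S_symmetric: "cinner (S x) y = cinner x (S y)"
  using T_symmetric[of "S x" "S y"] by simp

text \<open>The eigenvalue is encoded as \<open>norm (T x)\<close>: for a positive operator an
  eigenvalue is nonnegative, so on a unit eigenvector it equals the norm of the image. No separate
  eigenvalue function has to be carried along.\<close>

definition unit_eigenvectors :: "'a set" where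
  "unit_eigenvectors = {x \<in> D. norm x = 1 \<and> T x = complex_of_real (norm (T x)) *\<^sub>C x}"

lemma unit_eigenvectorD:
  assumes "b \<in> unit_eigenvectors"
  shows "b \<in> D" "norm b = 1" "T b = complex_of_real (norm (T b)) *\<^sub>C b" "norm (T b) > 0"
  using assms T_eq_zero[of b] by (auto simp: unit_eigenvectors_def)

text \<open>\<open>T\<close> multiplies the coefficient along an eigenvector by its eigenvalue, and
  \<open>S\<close> divides by it. Hence both preserve orthogonality to a set of
  eigenvectors.\<close>

lemma cinner_T_eigenvector:
  assumes "x \<in> D" "b \<in> unit_eigenvectors"
  shows "cinner (T x) b = complex_of_real (norm (T b)) * cinner x b"
  using T_symmetric[OF assms(1) unit_eigenvectorD(1)[OF assms(2)]]
    unit_eigenvectorD(3)[OF assms(2)] cinner_scaleC_right[of x "complex_of_real (norm (T b))" b]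
  by simp

lemma cinner_S_eigenvector:
  assumes "b \<in> unit_eigenvectors"
  shows "cinner (S y) b = cinner y b / complex_of_real (norm (T b))"
  using cinner_T_eigenvector[of "S y" b] assms unit_eigenvectorD(4)[OF assms]
  by (simp add: field_simps)

text \<open>A minimizer \<open>x\<close> of \<open>\<parallel>T x\<parallel>\<close> on \<open>B\<^sup>\<bottom>\<close> satisfies \<open>T\<^sup>2 x = m\<^sup>2 x\<close> by
  the first variation, and positivity makes \<open>T + m\<close> injective.\<close>

lemma exists_orthogonal_eigenvector:
  assumes B: "B \<subseteq> unit_eigenvectors" and y: "y \<noteq> 0" "\<And>b. b \<in> B \<Longrightarrow> cinner y b = 0"
  obtains x where "x \<in> unit_eigenvectors" "\<And>b. b \<in> B \<Longrightarrow> cinner x b = 0"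
proof -
  define N where "N = {x. \<forall>b\<in>B. cinner x b = 0}"
  have N: "csubspace N" "closed N"
    unfolding N_def by (rule csubspace_orthogonal, rule closed_orthogonal)
  have S_N: "S z \<in> N" if "z \<in> N" for z
    using that B by (auto simp: N_def cinner_S_eigenvector subset_iff)
  \<comment> \<open>The vector \<open>y\<close> lies in \<open>N\<close> but perhaps not in
    \<open>D\<close>; \<open>S y\<close> lies in both and makes the minimum attainment hypothesis
    applicable to \<open>N\<close>.\<close>
  have "S y \<in> D \<inter> N"
    using y S_N by (simp add: N_def)
  moreover have "S y \<noteq> 0"
    using T_S[of y] y(1) by force
  ultimately have "D \<inter> N \<noteq> {0}"
    by blast
  then obtain x where x: "x \<in> D" "x \<in> N" "norm x = 1"
    and min: "\<And>z. z \<in> D \<Longrightarrow> z \<in> N \<Longrightarrow> norm (T x) * norm z \<le> norm (T z)"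
    using minimum_attained[OF N] by blast
  define m where "m = norm (T x)"
  have "m > 0"
    using x T_eq_zero[of x] by (auto simp: m_def)
  have variation: "cinner (T x) (T z) = complex_of_real (m\<^sup>2) * cinner x z" if z: "z \<in> D" "z \<in> N" for z
  proof -
    \<comment> \<open>\<open>w\<close> is the defect in the first variation; \<open>K\<close> is the
      second-order coefficient of the perturbation.\<close>
    define w where "w = cinner (T x) (T z) - complex_of_real (m\<^sup>2) * cinner x z"
    define K where "K = (norm (T z))\<^sup>2 - m\<^sup>2 * (norm z)\<^sup>2"
    have *: "2 * r * (cmod w)\<^sup>2 \<le> r\<^sup>2 * (cmod w)\<^sup>2 * K" for r :: real
    proof -
      \<comment> \<open>Perturbing along \<open>z\<close> with a multiple of \<open>w\<close> itself
        aligns the phase: the linear term becomes the real number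
        \<open>2 * r * (cmod w)\<^sup>2\<close>.\<close>
      define a where "a = complex_of_real r * w"
      have D: "a *\<^sub>C z \<in> D" "x - a *\<^sub>C z \<in> D" "x - a *\<^sub>C z \<in> N"
        using x z N(1) by (auto intro: diff_in_D scaleC_in_D complex_vector.subspace_diff
            complex_vector.subspace_scale)
      have "(m * norm (x - a *\<^sub>C z))\<^sup>2 \<le> (norm (T x - a *\<^sub>C T z))\<^sup>2"
        using min[OF D(2,3)] x(1) z(1) D(1) \<open>m > 0\<close>
        by (intro power_mono) (auto simp: m_def T_diff T_scaleC)
      then have "m\<^sup>2 * (1 - 2 * Re (cnj a * cinner x z) + (cmod a)\<^sup>2 * (norm z)\<^sup>2)
          \<le> m\<^sup>2 - 2 * Re (cnj a * cinner (T x) (T z)) + (cmod a)\<^sup>2 * (norm (T z))\<^sup>2"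
        by (simp add: power_mult_distrib norm_diff_square x(3) cinner_scaleC_right norm_scaleC
            flip: m_def)
      then have "2 * Re (cnj a * w) \<le> (cmod a)\<^sup>2 * K"
        unfolding w_def K_def by (simp add: algebra_simps)
      moreover have "cnj a * w = complex_of_real (r * (cmod w)\<^sup>2)"
        by (simp add: a_def complex_norm_square mult.commute del: of_real_power)
      moreover have "(cmod a)\<^sup>2 = r\<^sup>2 * (cmod w)\<^sup>2"
        by (simp add: a_def norm_mult power_mult_distrib)
      ultimately show ?thesis
        by (simp del: of_real_mult of_real_power)
    qed
    have "w = 0"
    proof (rule ccontr)
      assume "w \<noteq> 0"
      have "2 * r \<le> r\<^sup>2 * K" for r :: real
      proof -
        have "(2 * r) * (cmod w)\<^sup>2 \<le> (r\<^sup>2 * K) * (cmod w)\<^sup>2"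
          using *[of r] by (simp add: mult_ac)
        then show ?thesis
          using \<open>w \<noteq> 0\<close> by simp
      qed
      \<comment> \<open>r = 1 gives K \<ge> 2, and then r = 1/K gives 2/K \<le> 1/K, a
        contradiction.\<close>
      from this[of 1] this[of "1 / K"] show False
        by (simp add: power2_eq_square field_simps split: if_splits)
    qed
    then show ?thesis
      by (simp add: w_def)
  qed
  have Tx_N: "T x \<in> N"
    using x B by (auto simp: N_def cinner_T_eigenvector subset_iff)
  \<comment> \<open>At this point \<open>T x\<close> is not known to lie in \<open>D\<close>, so the
    identity for the square of \<open>T\<close> is proved with one \<open>S\<close> applied to it.
    Testing the variation against \<open>S w\<close> makes \<open>w\<close> orthogonal to itself,
    and \<open>T x \<in> D\<close> follows.\<close>
  define w where "w = T x - complex_of_real (m\<^sup>2) *\<^sub>C S x"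
  have "w \<in> N"
    unfolding w_def using N(1) Tx_N S_N[OF x(2)]
    by (intro complex_vector.subspace_diff complex_vector.subspace_scale)
  then have "cinner w w = 0"
    using variation[of "S w"] S_N[of w] T_symmetric[of "S x" "S w"] S_symmetric[of x w]
    by (simp add: w_def cinner_diff_left cinner_scaleC_left)
  then have Tx: "T x = complex_of_real (m\<^sup>2) *\<^sub>C S x"
    by (simp add: cinner_self_eq_zero w_def)
  then have TxD: "T x \<in> D" and TTx: "T (T x) = complex_of_real (m\<^sup>2) *\<^sub>C x"
    by (auto simp: scaleC_in_D T_scaleC)
  define z where "z = T x - complex_of_real m *\<^sub>C x"
  have "z \<in> D"
    unfolding z_def using TxD x(1) by (intro diff_in_D scaleC_in_D)
  have "T z = complex_of_real (- m) *\<^sub>C z"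
    unfolding z_def using TxD x(1)
    by (simp add: T_diff scaleC_in_D T_scaleC TTx complex_vector.scale_right_diff_distrib
        scaleC_scaleC power2_eq_square)
  then have "Re (cinner (T z) z) = - m * (norm z)\<^sup>2"
    by (simp add: cinner_scaleC_left cinner_minus_left cinner_self del: of_real_power)
  moreover have "Re (cinner (T z) z) \<ge> 0"
    using pos \<open>z \<in> D\<close> by (auto simp: positive_operator_def complex_nonneg_Reals_iff)
  ultimately have "m * (norm z)\<^sup>2 \<le> 0"
    by simp
  then have "z = 0"
    using \<open>m > 0\<close> by (simp add: mult_le_0_iff)
  then have "x \<in> unit_eigenvectors"
    using x by (simp add: unit_eigenvectors_def z_def m_def)
  with x(2) that show ?thesis
    by (auto simp: N_def)
qed

lemma exists_eigenbasis:
  obtains B where "B \<subseteq> unit_eigenvectors" "orthonormal_on B (\<lambda>x. x)"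
    "\<And>y. (\<And>b. b \<in> B \<Longrightarrow> cinner y b = 0) \<Longrightarrow> y = 0"
proof -
  obtain B where B: "B \<subseteq> unit_eigenvectors" "orthonormal_on B (\<lambda>x. x)"
    "\<And>x. x \<in> unit_eigenvectors \<Longrightarrow> norm x = 1 \<Longrightarrow> \<exists>b\<in>B. cinner x b \<noteq> 0"
    using exists_maximal_orthonormal by metis
  have "y = 0" if "\<And>b. b \<in> B \<Longrightarrow> cinner y b = 0" for y
    using exists_orthogonal_eigenvector[OF B(1), of y] B(3) that unit_eigenvectorD(2) by metis
  with B that show ?thesis
    by blast
qed

text \<open>Choose unit vectors \<open>v\<^sub>n = c\<^sub>n \<phi>\<^sub>n + s\<^sub>n \<psi>\<^sub>n\<close> with
  \<open>\<parallel>T v\<^sub>n\<parallel>\<^sup>2 = C\<^sup>2 + 1/(n+2)\<close>: the \<open>v\<^sub>n\<close> and the \<open>T v\<^sub>n\<close> are orthogonal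
  families, so \<open>\<parallel>T x\<parallel> > C \<parallel>x\<parallel>\<close> on the closed span of the \<open>v\<^sub>n\<close>, although the
  infimum of \<open>\<parallel>T x\<parallel>\<close> there is at most \<open>C\<close>.\<close>

lemma no_separated_eigenvector_sequences:
  fixes \<phi> \<psi> :: "nat \<Rightarrow> 'a"
  assumes eig: "\<And>n. \<phi> n \<in> unit_eigenvectors" "\<And>n. \<psi> n \<in> unit_eigenvectors"
    and orth: "\<And>m n. cinner (\<phi> m) (\<phi> n) = (if m = n then 1 else 0)"
      "\<And>m n. cinner (\<psi> m) (\<psi> n) = (if m = n then 1 else 0)"
      "\<And>m n. cinner (\<phi> m) (\<psi> n) = 0"
    and C: "C \<ge> 0" "\<And>n. norm (T (\<phi> n)) \<le> C" "\<And>n. norm (T (\<psi> n)) \<ge> C + 1"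
  shows False
proof -
  define a b where "a n = (norm (T (\<phi> n)))\<^sup>2" and "b n = (norm (T (\<psi> n)))\<^sup>2" for n
  \<comment> \<open>The shift by 2 keeps the added term strictly between 0 and 1, so
    \<open>t n\<close> lies between \<open>a n\<close> and \<open>b n\<close> for every
    \<open>n\<close>, including 0.\<close>
  define t where "t n = C\<^sup>2 + inverse (real (Suc (Suc n)))" for n
  \<comment> \<open>The convex weight solving \<open>(1 - p n) * a n + p n * b n = t n\<close>; its
    square roots are the coefficients that make \<open>v n\<close> a unit vector.\<close>
  define p where "p n = (t n - a n) / (b n - a n)" for n
  define v where "v n = complex_of_real (sqrt (1 - p n)) *\<^sub>C \<phi> n + complex_of_real (sqrt (p n)) *\<^sub>C \<psi> n" for n
  have a: "a n \<le> C\<^sup>2" for n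
    unfolding a_def using C(2) by (intro power_mono) auto
  have "(C + 1)\<^sup>2 \<le> b n" for n
    unfolding b_def using C(1,3) by (intro power_mono) auto
  then have b: "C\<^sup>2 + 1 \<le> b n" for n
    using C(1) by (smt (verit) power2_sum one_power2 mult_nonneg_nonneg)
  have t: "C\<^sup>2 < t n" "t n < C\<^sup>2 + 1" for n
    by (auto simp: t_def inverse_less_1_iff)
  have t_pos: "t n > 0" for n
    using t(1)[of n] by (smt (verit) zero_le_power2)
  have ba: "b n - a n > 0" for n
    using a[of n] b[of n] by linarith
  have p: "p n \<ge> 0" "p n \<le> 1" for n
    using a[of n] b[of n] t[of n] ba[of n] by (auto simp: p_def)
  have p_t: "(1 - p n) * a n + p n * b n = t n" for n
  proof -
    have "p n * (b n - a n) = t n - a n"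
      using ba[of n] by (simp add: p_def)
    then show ?thesis
      by (simp add: algebra_simps)
  qed
  have D: "\<phi> n \<in> D" "\<psi> n \<in> D" for n
    using eig by (auto dest: unit_eigenvectorD)
  have vD: "v n \<in> D" for n
    by (simp add: v_def D add_in_D scaleC_in_D)
  have orth': "cinner (\<psi> m) (\<phi> n) = 0" for m n
    using orth(3) by (simp add: cinner_eq_zero_commute)
  have "sqrt (1 - p n) * sqrt (1 - p n) = 1 - p n" "sqrt (p n) * sqrt (p n) = p n" for n
    using p[of n] by auto
  then have sq: "complex_of_real (sqrt (1 - p n)) * complex_of_real (sqrt (1 - p n)) = of_real (1 - p n)"
    "complex_of_real (sqrt (p n)) * complex_of_real (sqrt (p n)) = of_real (p n)" for n
    by (metis of_real_mult)+
  have v_orth: "cinner (v m) (v n) = (if m = n then 1 else 0)" for m n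
    by (simp add: v_def cinner_add_left cinner_add_right cinner_scaleC_left cinner_scaleC_right
        orth orth' sq)
  \<comment> \<open>The explicit value of \<open>T (T (v n))\<close>. By symmetry it gives all inner
    products of the \<open>T (v n)\<close>.\<close>
  define TT where "TT n = complex_of_real (sqrt (1 - p n) * a n) *\<^sub>C \<phi> n
    + complex_of_real (sqrt (p n) * b n) *\<^sub>C \<psi> n" for n
  have T\<phi>: "T (\<phi> n) = complex_of_real (norm (T (\<phi> n))) *\<^sub>C \<phi> n"
    and T\<psi>: "T (\<psi> n) = complex_of_real (norm (T (\<psi> n))) *\<^sub>C \<psi> n" for n
    using eig unit_eigenvectorD(3) by blast+
  have Tv: "T (v n) = complex_of_real (sqrt (1 - p n) * norm (T (\<phi> n))) *\<^sub>C \<phi> n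
      + complex_of_real (sqrt (p n) * norm (T (\<psi> n))) *\<^sub>C \<psi> n" for n
  proof -
    have "T (v n) = complex_of_real (sqrt (1 - p n)) *\<^sub>C T (\<phi> n) + complex_of_real (sqrt (p n)) *\<^sub>C T (\<psi> n)"
      by (simp add: v_def D scaleC_in_D T_add T_scaleC)
    then show ?thesis
      by (subst (asm) T\<phi>, subst (asm) T\<psi>) (simp add: scaleC_scaleC)
  qed
  have TvD: "T (v n) \<in> D" for n
    unfolding Tv by (simp add: D add_in_D scaleC_in_D)
  have TTv: "T (T (v n)) = TT n" for n
  proof -
    have "T (T (v n)) = complex_of_real (sqrt (1 - p n) * norm (T (\<phi> n))) *\<^sub>C T (\<phi> n)
      + complex_of_real (sqrt (p n) * norm (T (\<psi> n))) *\<^sub>C T (\<psi> n)"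
      by (subst Tv) (simp add: D scaleC_in_D T_add T_scaleC)
    then show ?thesis
      by (subst (asm) (2) T\<phi>, subst (asm) (2) T\<psi>)
        (simp add: scaleC_scaleC TT_def a_def b_def power2_eq_square mult.assoc)
  qed
  have v_TT: "cinner (v m) (TT n) = (if m = n then complex_of_real (t n) else 0)" for m n
  proof -
    have sq': "complex_of_real (sqrt (1 - p n)) * z * complex_of_real (sqrt (1 - p n)) = of_real (1 - p n) * z"
      "complex_of_real (sqrt (p n)) * z * complex_of_real (sqrt (p n)) = of_real (p n) * z" for z
      by (simp_all only: sq[symmetric] mult_ac)
    have "cinner (v n) (TT n) = complex_of_real ((1 - p n) * a n + p n * b n)"
      by (simp add: v_def TT_def cinner_add_left cinner_add_right cinner_scaleC_left
          cinner_scaleC_right orth orth' sq')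
    moreover have "m \<noteq> n \<Longrightarrow> cinner (v m) (TT n) = 0"
      by (simp add: v_def TT_def cinner_add_left cinner_add_right cinner_scaleC_left
          cinner_scaleC_right orth orth')
    ultimately show ?thesis
      by (simp add: p_t)
  qed
  have Tv_Tv: "cinner (T (v m)) (T (v n)) = (if m = n then complex_of_real (t n) else 0)" for m n
    by (simp add: T_symmetric[OF vD TvD] TTv v_TT)
  have norm_Tv: "(norm (T (v n)))\<^sup>2 = t n" for n
    using Tv_Tv[of n n] by (simp add: cinner_self del: of_real_power)
  define w where "w n = complex_of_real (1 / sqrt (t n)) *\<^sub>C T (v n)" for n
  have v_on: "orthonormal_on UNIV v"
    by (simp add: orthonormal_on_def v_orth)
  have "cinner (w m) (w n) = (if m = n then 1 else 0)" for m n
  proof -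
    have "complex_of_real (sqrt (t n)) * complex_of_real (sqrt (t n)) = complex_of_real (t n)"
      using t_pos[of n] by (simp flip: of_real_mult)
    then show ?thesis
      using t_pos[of n] by (simp add: w_def cinner_scaleC_left cinner_scaleC_right Tv_Tv)
  qed
  then have w_on: "orthonormal_on UNIV w"
    by (simp add: orthonormal_on_def)
  \<comment> \<open>The closed span of the \<open>v n\<close>, written as a double orthogonal
    complement: closedness is immediate and \<open>orthonormal_expansion\<close> applies
    directly.\<close>
  define M where "M = {x. \<forall>y\<in>{y. \<forall>n. cinner y (v n) = 0}. cinner x y = 0}"
  have vM: "v n \<in> M" for n
    by (auto simp: M_def cinner_eq_zero_commute)
  have "v 0 \<noteq> 0"
    using v_orth[of 0 0] by auto
  with vM[of 0] vD[of 0] have "D \<inter> M \<noteq> {0}"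
    by blast
  then obtain x where x: "x \<in> D" "x \<in> M" "norm x = 1"
    and min: "\<And>z. z \<in> D \<Longrightarrow> z \<in> M \<Longrightarrow> norm (T x) * norm z \<le> norm (T z)"
    using minimum_attained[of M] csubspace_orthogonal closed_orthogonal unfolding M_def by blast
  have "norm (T x) \<le> norm (T (v n))" for n
    using min[OF vD vM, of n] orthonormal_on_norm[OF v_on, of n] by simp
  then have "(norm (T x))\<^sup>2 \<le> t n" for n
    unfolding norm_Tv[symmetric] by (intro power_mono) auto
  moreover have "t \<longlonglongrightarrow> C\<^sup>2 + 0"
    unfolding t_def
    by (intro tendsto_add tendsto_const LIMSEQ_Suc[OF LIMSEQ_inverse_real_of_nat])
  ultimately have Tx_le: "(norm (T x))\<^sup>2 \<le> C\<^sup>2"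
    using LIMSEQ_le_const[of t "C\<^sup>2" "(norm (T x))\<^sup>2"] by auto
  have x_expansion: "((\<lambda>n. cinner x (v n) *\<^sub>C v n) has_sum x) UNIV"
    by (rule orthonormal_expansion[OF v_on])
      (use x(2) in \<open>auto simp: M_def cinner_eq_zero_commute[of _ x]\<close>)
  from orthonormal_norm_has_sum[OF v_on x_expansion]
  have sum1: "((\<lambda>n. (cmod (cinner x (v n)))\<^sup>2) has_sum 1) UNIV"
    using x(3) by simp
  \<comment> \<open>The unbounded \<open>T\<close> cannot be applied to the expansion of
    \<open>x\<close> term by term. Instead \<open>T\<close> is moved to the other side, where
    pairing with the fixed vector \<open>TT n\<close> is continuous and only the n-th term
    survives.\<close>
  have coeff: "(cmod (cinner (T x) (w n)))\<^sup>2 = t n * (cmod (cinner x (v n)))\<^sup>2" for n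
  proof -
    have "cinner (x - cinner x (v n) *\<^sub>C v n) (TT n) = 0"
    proof -
      have "((\<lambda>i. cinner x (v i) *\<^sub>C v i) has_sum (x - cinner x (v n) *\<^sub>C v n)) (UNIV - {n})"
        using has_sum_Diff[OF x_expansion has_sum_finite[of "{n}"]] by simp
      then show ?thesis
        by (rule orthogonal_has_sum) (simp add: cinner_scaleC_left v_TT)
    qed
    then have "cinner x (TT n) = t n * cinner x (v n)"
      by (simp add: cinner_diff_left cinner_scaleC_left v_TT)
    then have "cinner (T x) (T (v n)) = t n * cinner x (v n)"
      by (simp add: T_symmetric[OF x(1) TvD] TTv)
    then show ?thesis
      using t_pos[of n]
      by (simp add: w_def cinner_scaleC_right norm_mult norm_divide power_mult_distrib power_divide
          power2_eq_square)
  qed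
  obtain L where L: "((\<lambda>n. (cmod (cinner (T x) (w n)))\<^sup>2) has_sum L) UNIV"
    using bessel_summable[OF w_on] by (auto simp: summable_on_def)
  \<comment> \<open>Bessel bounds \<open>L\<close>, the sum of
    \<open>t n * (cmod (cinner x (v n)))\<^sup>2\<close>, by the squared minimum, which is at most
    \<open>C\<^sup>2\<close>. As every \<open>t n\<close> exceeds \<open>C\<^sup>2\<close> and some
    coefficient is nonzero, \<open>L\<close> is also strictly larger than
    \<open>C\<^sup>2\<close>.\<close>
  have "L \<le> (norm (T x))\<^sup>2"
    by (rule has_sum_le_finite_sums[OF L]) (rule bessel_finite[OF w_on])
  moreover have "C\<^sup>2 * 1 < L"
  proof -
    have "\<exists>n. cinner x (v n) \<noteq> 0"
    proof (rule ccontr)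
      assume "\<nexists>n. cinner x (v n) \<noteq> 0"
      then show False
        using has_sum_unique[OF sum1 has_sum_0] by simp
    qed
    then obtain n where "cinner x (v n) \<noteq> 0" ..
    then show ?thesis
      using t(1) by (intro has_sum_strict_mono[OF has_sum_cmult_right[OF sum1] L, of _ n])
        (auto simp: coeff less_imp_le intro!: mult_right_mono)
  qed
  ultimately show False
    using Tx_le by simp
qed

lemma finite_eigenvalue_levels:
  assumes B: "B \<subseteq> unit_eigenvectors" "orthonormal_on B (\<lambda>x. x)"
    "\<And>y. (\<And>b. b \<in> B \<Longrightarrow> cinner y b = 0) \<Longrightarrow> y = 0"
  shows "finite {b \<in> B. norm (T b) \<le> C}"
proof (rule ccontr)
  assume inf: "infinite {b \<in> B. norm (T b) \<le> C}"
  then obtain b0 where "b0 \<in> B" "norm (T b0) \<le> C"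
    using not_finite_existsD by blast
  then have "C \<ge> 0"
    using norm_ge_zero order_trans by blast
  have "infinite {b \<in> B. norm (T b) \<ge> C + 1}"
  proof
    assume fin: "finite {b \<in> B. norm (T b) \<ge> C + 1}"
    \<comment> \<open>Inserting \<open>C + 1\<close> keeps the maximum meaningful for an empty set
      and covers the eigenvalues below \<open>C + 1\<close>.\<close>
    define K where "K = Max (insert (C + 1) ((\<lambda>b. norm (T b)) ` {b \<in> B. norm (T b) \<ge> C + 1}))"
    have K: "norm (T b) \<le> K" if "b \<in> B" for b
    proof (cases "norm (T b) \<ge> C + 1")
      case True
      then show ?thesis
        unfolding K_def using fin that by (intro Max_ge) auto
    next
      case False
      moreover have "C + 1 \<le> K"
        unfolding K_def using fin by (intro Max_ge) auto
      ultimately show ?thesis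
        by simp
    qed
    have "K \<ge> 0"
      using K[OF \<open>b0 \<in> B\<close>] norm_ge_zero order_trans by blast
    \<comment> \<open>Parseval for \<open>T x\<close> and for \<open>x\<close> turns the
      coefficientwise bound by \<open>K\<close> into a bound for \<open>T\<close>, contradicting
      unboundedness.\<close>
    have "norm (T x) \<le> K * norm x" if "x \<in> D" for x
    proof (rule power2_le_imp_le)
      have parseval: "((\<lambda>b. (cmod (cinner y b))\<^sup>2) has_sum (norm y)\<^sup>2) B" for y
        using orthonormal_norm_has_sum[OF B(2) orthonormal_basis_expansion[OF B(2,3)]] by simp
      have "(cmod (cinner (T x) b))\<^sup>2 \<le> K\<^sup>2 * (cmod (cinner x b))\<^sup>2" if "b \<in> B" for b
      proof -
        have "b \<in> unit_eigenvectors"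
          using that B(1) by blast
        then show ?thesis
          using cinner_T_eigenvector[OF \<open>x \<in> D\<close>] K[OF that]
          by (auto simp: norm_mult power_mult_distrib intro!: mult_right_mono power_mono)
      qed
      then have "(norm (T x))\<^sup>2 \<le> K\<^sup>2 * (norm x)\<^sup>2"
        by (rule has_sum_mono[OF parseval has_sum_cmult_right[OF parseval]])
      then show "(norm (T x))\<^sup>2 \<le> (K * norm x)\<^sup>2"
        by (simp add: power_mult_distrib)
      show "0 \<le> K * norm x"
        using \<open>K \<ge> 0\<close> by simp
    qed
    with T_unbounded[of K] show False
      by (meson not_le)
  qed
  then obtain \<psi> :: "nat \<Rightarrow> 'a" where \<psi>: "inj \<psi>" "range \<psi> \<subseteq> {b \<in> B. norm (T b) \<ge> C + 1}"
    using infinite_countable_subset by blast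
  obtain \<phi> :: "nat \<Rightarrow> 'a" where \<phi>: "inj \<phi>" "range \<phi> \<subseteq> {b \<in> B. norm (T b) \<le> C}"
    using infinite_countable_subset[OF inf] by blast
  have mem: "\<phi> n \<in> B" "\<psi> n \<in> B" "norm (T (\<phi> n)) \<le> C" "norm (T (\<psi> n)) \<ge> C + 1" for n
    using \<phi>(2) \<psi>(2) by blast+
  \<comment> \<open>The gap of 1 between the two eigenvalue ranges separates the sequences, so
    orthonormality of \<open>B\<close> makes them mutually orthogonal.\<close>
  have "\<phi> m \<noteq> \<psi> n" for m n
    using mem(3)[of m] mem(4)[of n] by auto
  then show False
    using orthonormal_onD[OF B(2)] mem B(1) \<open>C \<ge> 0\<close> inj_eq[OF \<phi>(1)] inj_eq[OF \<psi>(1)]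
    by (intro no_separated_eigenvector_sequences[of \<phi> \<psi> C]) auto
qed

end

section \<open>Enumerating the eigenbasis\<close>

text \<open>Greedy choice: repeatedly take an element of least \<open>f\<close> among those not yet
  taken. A least one exists since only a finite sublevel set competes.\<close>

lemma exists_increasing_enumeration:
  fixes f :: "'a \<Rightarrow> real"
  assumes "infinite B" "\<And>C. finite {b \<in> B. f b \<le> C}"
  obtains \<phi> :: "nat \<Rightarrow> 'a" where "inj \<phi>" "range \<phi> = B" "incseq (\<lambda>n. f (\<phi> n))"
proof -
  have ex_min: "\<exists>b. b \<in> B - F \<and> (\<forall>x\<in>B - F. f b \<le> f x)" if "finite F" for F
  proof -
    have "infinite (B - F)"
      using that assms(1) by (rule Diff_infinite_finite)
    then obtain c where c: "c \<in> B - F"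
      using infinite_imp_nonempty by blast
    let ?L = "{b \<in> B. f b \<le> f c} - F"
    have "finite ?L" "?L \<noteq> {}"
      using assms(2) c by auto
    then obtain b where b: "b \<in> ?L" "\<And>x. x \<in> ?L \<Longrightarrow> f b \<le> f x"
      using arg_min_if_finite(1)[of ?L f] arg_min_least[of ?L _ f] by blast
    have "f b \<le> f x" if "x \<in> B - F" for x
    proof (cases "f x \<le> f c")
      case False
      then show ?thesis
        using b(1) by auto
    qed (use b(2) that in auto)
    with b(1) show ?thesis
      by blast
  qed
  define pick where "pick F = (SOME b. b \<in> B - F \<and> (\<forall>x\<in>B - F. f b \<le> f x))" for F
  have pick: "pick F \<in> B - F" "\<And>x. x \<in> B - F \<Longrightarrow> f (pick F) \<le> f x" if "finite F" for F
    using someI_ex[OF ex_min[OF that]] unfolding pick_def by blast+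
  define F where "F = rec_nat {} (\<lambda>_ X. insert (pick X) X)"
  have F_simps: "F 0 = {}" "F (Suc n) = insert (pick (F n)) (F n)" for n
    by (simp_all add: F_def)
  have fin: "finite (F n)" for n
    by (induction n) (auto simp: F_simps)
  have F_mono: "m \<le> n \<Longrightarrow> F m \<subseteq> F n" for m n
    by (rule lift_Suc_mono_le[of F]) (auto simp: F_simps)
  define \<phi> where "\<phi> n = pick (F n)" for n
  have \<phi>: "\<phi> n \<in> B" "\<phi> n \<notin> F n" for n
    using pick(1)[OF fin] by (auto simp: \<phi>_def)
  have \<phi>_F: "\<phi> m \<in> F n" if "m < n" for m n
    using F_mono[of "Suc m" n] that by (auto simp: F_simps \<phi>_def)
  have "inj \<phi>"
    by (rule linorder_injI) (metis \<phi>(2) \<phi>_F)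
  moreover have "incseq (\<lambda>n. f (\<phi> n))"
  proof (rule incseq_SucI)
    fix n
    have "\<phi> (Suc n) \<in> B - F n"
      using \<phi>[of "Suc n"] by (auto simp: F_simps)
    then show "f (\<phi> n) \<le> f (\<phi> (Suc n))"
      unfolding \<phi>_def[of n] by (rule pick(2)[OF fin])
  qed
  moreover have "range \<phi> = B"
  proof (rule ccontr)
    assume "range \<phi> \<noteq> B"
    then obtain b where b: "b \<in> B" "b \<notin> range \<phi>"
      using \<phi>(1) by blast
    have "b \<notin> F n" for n
      by (induction n) (use b in \<open>auto simp: F_simps \<phi>_def\<close>)
    \<comment> \<open>An element that is never picked stays a candidate at every stage, so all
      picked values are at most its own: infinitely many elements would share a finite
      level.\<close>
    then have "range \<phi> \<subseteq> {x \<in> B. f x \<le> f b}"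
      using \<phi>(1) b(1) pick(2)[OF fin] by (auto simp: \<phi>_def)
    then have "finite (range \<phi>)"
      using assms(2) finite_subset by blast
    with \<open>inj \<phi>\<close> show False
      using finite_imageD infinite_UNIV_nat by blast
  qed
  ultimately show ?thesis
    using that by blast
qed

section \<open>Linear inverses and compactness criteria\<close>

lemma linear_operator_inv_into:
  assumes "linear_operator D A" "bij_betw A D UNIV"
  shows "linear_operator UNIV (inv_into D A)"
proof -
  let ?R = "inv_into D A"
  have D: "csubspace D"
    using assms(1) by (simp add: linear_operator_def)
  have R: "?R y \<in> D" "A (?R y) = y" for y
    using assms(2) by (auto simp: bij_betw_def inv_into_into f_inv_into_f)
  have R_eq: "?R y = x" if "x \<in> D" "A x = y" for x y
    using assms(2) that by (auto simp: bij_betw_def)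
  have "?R (x + y) = ?R x + ?R y" for x y
    using assms(1) by (intro R_eq) (auto simp: linear_operator_def R intro: complex_vector.subspace_add[OF D])
  moreover have "?R (a *\<^sub>C x) = a *\<^sub>C ?R x" for a x
    using assms(1) by (intro R_eq) (auto simp: linear_operator_def R intro: complex_vector.subspace_scale[OF D])
  ultimately show ?thesis
    by (simp add: linear_operator_def)
qed

text \<open>Induction on \<open>F\<close>: each index adds a continuous image of a closed disc, and
  sums of two compact sets are compact.\<close>

lemma compact_finite_combinations:
  fixes e :: "'i \<Rightarrow> 'a::complex_hilbert"
  assumes "finite F"
  shows "compact {\<Sum>i\<in>F. c i *\<^sub>C e i | c. \<forall>i\<in>F. cmod (c i) \<le> r}"
  using assms
proof (induction F rule: finite_induct)
  case (insert j F)
  have "compact ((\<lambda>a. a *\<^sub>C e j) ` cball 0 r)"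
    by (intro compact_continuous_image linear_continuous_on bounded_linear_scaleC_left compact_cball)
  from compact_sums[OF this insert.IH]
  have "compact {x + y | x y. x \<in> (\<lambda>a. a *\<^sub>C e j) ` cball 0 r
      \<and> y \<in> {\<Sum>i\<in>F. c i *\<^sub>C e i | c. \<forall>i\<in>F. cmod (c i) \<le> r}}" .
  also have "{x + y | x y. x \<in> (\<lambda>a. a *\<^sub>C e j) ` cball 0 r
      \<and> y \<in> {\<Sum>i\<in>F. c i *\<^sub>C e i | c. \<forall>i\<in>F. cmod (c i) \<le> r}}
    = {\<Sum>i\<in>insert j F. c i *\<^sub>C e i | c. \<forall>i\<in>insert j F. cmod (c i) \<le> r}" (is "?L = ?R")
  proof (intro equalityI subsetI)
    fix z assume "z \<in> ?L"
    then obtain a c where ac: "cmod a \<le> r" "\<forall>i\<in>F. cmod (c i) \<le> r"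
      "z = a *\<^sub>C e j + (\<Sum>i\<in>F. c i *\<^sub>C e i)"
      by auto
    have "(\<Sum>i\<in>F. (c(j := a)) i *\<^sub>C e i) = (\<Sum>i\<in>F. c i *\<^sub>C e i)"
      using insert.hyps(2) by (intro sum.cong) auto
    then have "z = (\<Sum>i\<in>insert j F. (c(j := a)) i *\<^sub>C e i)"
      using ac(3) insert.hyps by simp
    moreover have "\<forall>i\<in>insert j F. cmod ((c(j := a)) i) \<le> r"
      using ac(1,2) by simp
    ultimately show "z \<in> ?R"
      by blast
  next
    fix z assume "z \<in> ?R"
    then obtain c where c: "\<forall>i\<in>insert j F. cmod (c i) \<le> r" "z = (\<Sum>i\<in>insert j F. c i *\<^sub>C e i)"
      by blast
    then have "c j *\<^sub>C e j \<in> (\<lambda>a. a *\<^sub>C e j) ` cball 0 r" "z = c j *\<^sub>C e j + (\<Sum>i\<in>F. c i *\<^sub>C e i)"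
      using insert.hyps by auto
    then show "z \<in> ?L"
      using c(1) by blast
  qed
  finally show ?case .
qed simp

lemma compact_closure_totally_bounded:
  fixes A :: "'a::{complete_space} set"
  assumes "\<And>e. e > 0 \<Longrightarrow> \<exists>k. finite k \<and> A \<subseteq> (\<Union>x\<in>k. ball x e)"
  shows "compact (closure A)"
  unfolding compact_eq_totally_bounded
proof (intro conjI allI impI)
  show "complete (closure A)"
    by (simp add: complete_eq_closed)
  fix e :: real assume "e > 0"
  \<comment> \<open>Half the radius, because passing to the closure turns open balls into closed
    ones.\<close>
  then obtain k where k: "finite k" "A \<subseteq> (\<Union>x\<in>k. ball x (e/2))"
    using assms[of "e/2"] by auto
  have "closure A \<subseteq> (\<Union>x\<in>k. cball x (e/2))"
  proof (rule closure_minimal)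
    show "A \<subseteq> (\<Union>x\<in>k. cball x (e/2))"
      using k(2) ball_subset_cball by blast
    show "closed (\<Union>x\<in>k. cball x (e/2))"
      using k(1) by (intro closed_UN) auto
  qed
  also have "\<dots> \<subseteq> (\<Union>x\<in>k. ball x e)"
    using \<open>e > 0\<close> by (intro UN_mono order.refl) auto
  finally show "\<exists>k. finite k \<and> closure A \<subseteq> (\<Union>x\<in>k. ball x e)"
    using k(1) by blast
qed

section \<open>The operator as a diagonal operator in an increasing eigenbasis\<close>

locale eigenbasis_sequence = positive_am_operator D T for D :: "'a::complex_hilbert set" and T +
  fixes \<phi> :: "nat \<Rightarrow> 'a"
  assumes orthonormal: "orthonormal_on UNIV \<phi>"
    and eigen: "\<And>n. \<phi> n \<in> unit_eigenvectors"
    and total: "\<And>y. (\<And>n. cinner y (\<phi> n) = 0) \<Longrightarrow> y = 0"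
    and increasing: "incseq (\<lambda>n. norm (T (\<phi> n)))"
    and finite_levels: "\<And>C. finite {n. norm (T (\<phi> n)) \<le> C}"
begin

definition l :: "nat \<Rightarrow> real" where "l n = norm (T (\<phi> n))"

lemma l_pos: "l n > 0"
  using unit_eigenvectorD(4)[OF eigen] by (simp add: l_def)

lemma \<phi>_in_D: "\<phi> n \<in> D"
  using unit_eigenvectorD(1)[OF eigen] .

lemma T_\<phi>: "T (\<phi> n) = complex_of_real (l n) *\<^sub>C \<phi> n"
  using unit_eigenvectorD(3)[OF eigen] by (simp add: l_def)

lemma incseq_l: "incseq l"
  using increasing by (simp add: l_def[abs_def])

lemma finite_l: "finite {n. l n \<le> C}"
  using finite_levels by (simp add: l_def)

lemma l_not_bdd: "\<not> bdd_above (range l)"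
proof
  assume "bdd_above (range l)"
  then obtain C where "\<And>n. l n \<le> C"
    by (auto simp: bdd_above_def)
  then show False
    using finite_l[of C] by simp
qed

lemma expansion: "((\<lambda>n. cinner x (\<phi> n) *\<^sub>C \<phi> n) has_sum x) UNIV"
  using total by (intro orthonormal_basis_expansion[OF orthonormal]) blast

lemma parseval: "((\<lambda>n. (cmod (cinner x (\<phi> n)))\<^sup>2) has_sum (norm x)\<^sup>2) UNIV"
  by (rule orthonormal_norm_has_sum[OF orthonormal expansion])

text \<open>By Parseval, domination of coefficients is domination of norms. It yields both the
  resolvent bound and the tail estimate behind compactness.\<close>

lemma norm_le_coefficients:
  assumes "K \<ge> 0" "\<And>n. cmod (cinner x (\<phi> n)) \<le> K * cmod (cinner y (\<phi> n))"
  shows "norm x \<le> K * norm y"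
proof (rule power2_le_imp_le)
  have "(cmod (cinner x (\<phi> n)))\<^sup>2 \<le> K\<^sup>2 * (cmod (cinner y (\<phi> n)))\<^sup>2" for n
    using power_mono[OF assms(2), of n 2] by (simp add: power_mult_distrib)
  then have "(norm x)\<^sup>2 \<le> K\<^sup>2 * (norm y)\<^sup>2"
    by (rule has_sum_mono[OF parseval has_sum_cmult_right[OF parseval]])
  then show "(norm x)\<^sup>2 \<le> (K * norm y)\<^sup>2"
    by (simp add: power_mult_distrib)
qed (use assms(1) in simp)

lemma eq_by_coefficients:
  assumes "\<And>n. cinner x (\<phi> n) = cinner y (\<phi> n)"
  shows "x = y"
  using total[of "x - y"] assms by (simp add: cinner_diff_left)

lemma coefficient_T: "x \<in> D \<Longrightarrow> cinner (T x) (\<phi> n) = complex_of_real (l n) * cinner x (\<phi> n)"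
  using cinner_T_eigenvector[OF _ eigen] by (simp add: l_def)

lemma coefficient_S: "cinner (S y) (\<phi> n) = cinner y (\<phi> n) / complex_of_real (l n)"
  using cinner_S_eigenvector[OF eigen] by (simp add: l_def)

lemma inj_\<phi>: "inj \<phi>"
  using orthonormal by (metis injI orthonormal_onD UNIV_I zero_neq_one)

lemma eigenspace_coefficient:
  assumes "x \<in> eigenspace D T \<mu>" "cinner x (\<phi> n) \<noteq> 0"
  shows "\<mu> = complex_of_real (l n)"
  using assms coefficient_T[of x n] by (simp add: eigenspace_def cinner_scaleC_left)

text \<open>One inclusion is Parseval for \<open>T x\<close>. For the other, the weighted
  coefficients are those of some \<open>y\<close>; then \<open>S y\<close> and \<open>x\<close> have
  the same coefficients, and \<open>x\<close> is in the range of \<open>S\<close>.\<close>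

lemma domain_eq: "D = {x. summable (\<lambda>n. (l n)\<^sup>2 * (cmod (cinner x (\<phi> n)))\<^sup>2)}"
proof (intro equalityI subsetI CollectI)
  fix x assume "x \<in> D"
  then have "(\<lambda>n. (cmod (cinner (T x) (\<phi> n)))\<^sup>2) = (\<lambda>n. (l n)\<^sup>2 * (cmod (cinner x (\<phi> n)))\<^sup>2)"
    by (simp add: coefficient_T norm_mult power_mult_distrib)
  then show "summable (\<lambda>n. (l n)\<^sup>2 * (cmod (cinner x (\<phi> n)))\<^sup>2)"
    using sums_summable[OF has_sum_imp_sums[OF parseval[of "T x"]]] by simp
next
  fix x assume "x \<in> {x. summable (\<lambda>n. (l n)\<^sup>2 * (cmod (cinner x (\<phi> n)))\<^sup>2)}"
  then have "(\<lambda>n. (cmod (complex_of_real (l n) * cinner x (\<phi> n)))\<^sup>2) summable_on UNIV"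
    by (simp add: summable_on_UNIV_nonneg_real_iff norm_mult power_mult_distrib)
  from square_summable_orthonormal[OF orthonormal this]
  obtain y where y: "((\<lambda>n. (complex_of_real (l n) * cinner x (\<phi> n)) *\<^sub>C \<phi> n) has_sum y) UNIV"
    by (auto simp: summable_on_def)
  have "S y = x"
    using l_pos by (intro eq_by_coefficients)
      (simp add: coefficient_S orthonormal_coefficient[OF orthonormal y] less_imp_neq[symmetric])
  then show "x \<in> D"
    using S_in_D[of y] by simp
qed

text \<open>The series is the expansion of the vector \<open>T x\<close> itself, so no interchange
  of \<open>T\<close> with a limit occurs.\<close>

lemma T_sums:
  assumes "x \<in> D"
  shows "(\<lambda>n. (complex_of_real (l n) * cinner x (\<phi> n)) *\<^sub>C \<phi> n) sums T x"
  using has_sum_imp_sums[OF expansion[of "T x"]] by (simp add: coefficient_T[OF assms])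

lemma eigenvector_\<phi>: "eigenvector D T (complex_of_real (l n)) (\<phi> n)"
  using unit_eigenvectorD(2)[OF eigen, of n]
  by (auto simp: eigenvector_def eigenspace_def \<phi>_in_D T_\<phi>)

text \<open>Coefficients at indices with a different eigenvalue vanish, and finitely many indices
  remain, so the expansion is a finite sum and the span needs no closure.\<close>

lemma eigenspace_eq_span:
  "eigenspace D T (complex_of_real (l n)) = cspan (\<phi> ` {k. l k = l n})" (is "_ = cspan (\<phi> ` ?K)")
proof
  have "csubspace (eigenspace D T (complex_of_real (l n)))"
    by (auto simp: complex_vector.subspace_def eigenspace_def add_in_D scaleC_in_D T_add T_scaleC
        scaleC_add_right scaleC_scaleC mult.commute)
  moreover have "\<phi> ` ?K \<subseteq> eigenspace D T (complex_of_real (l n))"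
    by (auto simp: eigenspace_def \<phi>_in_D T_\<phi>)
  ultimately show "cspan (\<phi> ` ?K) \<subseteq> eigenspace D T (complex_of_real (l n))"
    by (intro complex_vector.span_minimal)
  show "eigenspace D T (complex_of_real (l n)) \<subseteq> cspan (\<phi> ` ?K)"
  proof
    fix x assume x: "x \<in> eigenspace D T (complex_of_real (l n))"
    have "cinner x (\<phi> k) = 0" if "k \<notin> ?K" for k
      using eigenspace_coefficient[OF x, of k] that by auto
    then have "((\<lambda>k. cinner x (\<phi> k) *\<^sub>C \<phi> k) has_sum x) UNIV
        \<longleftrightarrow> ((\<lambda>k. cinner x (\<phi> k) *\<^sub>C \<phi> k) has_sum x) ?K"
      by (intro has_sum_cong_neutral) auto
    then have "((\<lambda>k. cinner x (\<phi> k) *\<^sub>C \<phi> k) has_sum x) ?K"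
      using expansion[of x] by blast
    moreover have "finite ?K"
      by (rule finite_subset[OF _ finite_l[of "l n"]]) auto
    ultimately have "x = (\<Sum>k\<in>?K. cinner x (\<phi> k) *\<^sub>C \<phi> k)"
      using has_sum_finite has_sum_unique by blast
    also have "\<dots> \<in> cspan (\<phi> ` ?K)"
      by (intro complex_vector.span_sum complex_vector.span_scale complex_vector.span_base imageI)
    finally show "x \<in> cspan (\<phi> ` ?K)" .
  qed
qed

lemma finite_multiplicity: "finite {k. l k = l n}"
  by (rule finite_subset[OF _ finite_l[of "l n"]]) auto

text \<open>Makes precise that the sequence repeats each eigenvalue exactly according to its
  multiplicity.\<close>

lemma dim_eigenspace:
  "card {k. l k = l n} = complex_vector.dim (eigenspace D T (complex_of_real (l n)))"
proof -
  let ?B = "\<phi> ` {k. l k = l n}"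
  have on: "orthonormal_on ?B (\<lambda>x. x)"
    using orthonormal inj_\<phi> by (auto simp: orthonormal_on_def inj_eq)
  have "u v = 0" if "(\<Sum>v\<in>?B. u v *\<^sub>C v) = 0" "v \<in> ?B" for u v
    using cinner_orthonormal_sum[OF on order.refl finite_imageI[OF finite_multiplicity] that(2), of u] that
    by simp
  then have "\<not> complex_vector.dependent ?B"
    unfolding complex_vector.dependent_finite[OF finite_imageI[OF finite_multiplicity]] by blast
  then show ?thesis
    using card_image[OF inj_on_subset[OF inj_\<phi> subset_UNIV]]
    by (simp add: eigenspace_eq_span complex_vector.dim_eq_card_independent)
qed

lemma point_spectrum_eq: "point_spectrum D T = range (\<lambda>n. complex_of_real (l n))"
proof (intro equalityI subsetI)
  fix \<mu> assume "\<mu> \<in> point_spectrum D T"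
  then obtain x where x: "x \<in> eigenspace D T \<mu>" "x \<noteq> 0"
    by (auto simp: point_spectrum_def eigenvector_def)
  then obtain n where "cinner x (\<phi> n) \<noteq> 0"
    using total by blast
  then show "\<mu> \<in> range (\<lambda>n. complex_of_real (l n))"
    using eigenspace_coefficient[OF x(1)] by blast
next
  fix \<mu> assume "\<mu> \<in> range (\<lambda>n. complex_of_real (l n))"
  then show "\<mu> \<in> point_spectrum D T"
    using eigenvector_\<phi> by (auto simp: point_spectrum_def)
qed

section \<open>Spectrum and compactness of the inverse\<close>

lemma linear_operator_shift: "linear_operator D (\<lambda>x. T x - \<mu> *\<^sub>C x)"
  by (auto simp: linear_operator_def csubspace_D T_add T_scaleC scaleC_add_right
      complex_vector.scale_right_diff_distrib scaleC_scaleC mult.commute)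

lemma spectral_gap:
  assumes "\<mu> \<notin> range (\<lambda>n. complex_of_real (l n))"
  obtains d where "d > 0" "\<And>n. d \<le> cmod (complex_of_real (l n) - \<mu>)"
proof -
  define K where "K = {n. l n \<le> cmod \<mu> + 1}"
  \<comment> \<open>Outside the finite set \<open>K\<close> the distance to \<open>\<mu>\<close> is
    at least 1, so the inserted 1 accounts for all remaining indices.\<close>
  define d where "d = Min (insert 1 ((\<lambda>n. cmod (complex_of_real (l n) - \<mu>)) ` K))"
  have fin: "finite K"
    unfolding K_def by (rule finite_l)
  have "d > 0"
    unfolding d_def using assms fin by (subst Min_gr_iff) auto
  moreover have "d \<le> cmod (complex_of_real (l n) - \<mu>)" for n
  proof (cases "n \<in> K")
    case True
    then show ?thesis
      unfolding d_def using fin by (intro Min_le) auto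
  next
    case False
    have "d \<le> 1"
      unfolding d_def using fin by (intro Min_le) auto
    also have "1 \<le> l n - cmod \<mu>"
      using False by (simp add: K_def)
    also have "\<dots> \<le> cmod (complex_of_real (l n) - \<mu>)"
      using norm_triangle_ineq2[of "complex_of_real (l n)" \<mu>] l_pos[of n] by simp
    finally show ?thesis .
  qed
  ultimately show ?thesis
    using that by blast
qed

lemma spectrum_eq: "spectrum D T = range (\<lambda>n. complex_of_real (l n))"
proof (intro equalityI subsetI)
  fix \<mu> assume "\<mu> \<in> spectrum D T"
  show "\<mu> \<in> range (\<lambda>n. complex_of_real (l n))"
  proof (rule ccontr)
    assume "\<mu> \<notin> range (\<lambda>n. complex_of_real (l n))"
    then obtain d where d: "d > 0" "\<And>n. d \<le> cmod (complex_of_real (l n) - \<mu>)"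
      using spectral_gap by blast
    let ?A = "\<lambda>x. T x - \<mu> *\<^sub>C x"
    have coeff: "cinner (?A x) (\<phi> n) = (complex_of_real (l n) - \<mu>) * cinner x (\<phi> n)" if "x \<in> D" for x n
      by (simp add: coefficient_T[OF that] cinner_diff_left cinner_scaleC_left algebra_simps)
    have nz: "complex_of_real (l n) - \<mu> \<noteq> 0" for n
      using d(1) d(2)[of n] by auto
    have bound: "norm x \<le> 1 / d * norm (?A x)" if "x \<in> D" for x
    proof (rule norm_le_coefficients)
      fix n
      have "d * cmod (cinner x (\<phi> n)) \<le> cmod (cinner (?A x) (\<phi> n))"
        unfolding coeff[OF that] norm_mult using d(2) by (intro mult_right_mono) auto
      then show "cmod (cinner x (\<phi> n)) \<le> 1 / d * cmod (cinner (?A x) (\<phi> n))"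
        using d(1) by (simp add: field_simps)
    qed (use d(1) in simp)
    have "inj_on ?A D"
    proof (rule inj_onI)
      fix x y assume "x \<in> D" "y \<in> D" "?A x = ?A y"
      then have "(complex_of_real (l n) - \<mu>) * cinner x (\<phi> n) = (complex_of_real (l n) - \<mu>) * cinner y (\<phi> n)" for n
        using coeff by metis
      then show "x = y"
        using nz by (intro eq_by_coefficients) simp
    qed
    moreover have "y \<in> ?A ` D" for y
    proof -
      \<comment> \<open>The coefficients that a solution must have; the gap \<open>d\<close> makes
        them square summable.\<close>
      define c where "c n = cinner y (\<phi> n) / (complex_of_real (l n) - \<mu>)" for n
      have c_le: "(cmod (c n))\<^sup>2 \<le> (1 / d)\<^sup>2 * (cmod (cinner y (\<phi> n)))\<^sup>2" for n
      proof -
        have "cmod (c n) \<le> cmod (cinner y (\<phi> n)) / d"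
          unfolding c_def norm_divide using d by (intro frac_le) auto
        from power_mono[OF this, of 2] show ?thesis
          by (simp add: power_divide)
      qed
      have "(\<lambda>n. (1 / d)\<^sup>2 * (cmod (cinner y (\<phi> n)))\<^sup>2) summable_on UNIV"
        using has_sum_cmult_right[OF parseval] by (rule has_sum_imp_summable)
      then have "(\<lambda>n. (cmod (c n))\<^sup>2) summable_on UNIV"
        by (rule summable_on_comparison_test) (auto intro: c_le)
      from square_summable_orthonormal[OF orthonormal this]
      obtain x where x: "((\<lambda>n. c n *\<^sub>C \<phi> n) has_sum x) UNIV"
        by (auto simp: summable_on_def)
      \<comment> \<open>The equation \<open>T x = y + \<mu> x\<close> cannot be stated before
        \<open>x \<in> D\<close> is known; in terms of \<open>S\<close> it gives both at
        once.\<close>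
      have "S (y + \<mu> *\<^sub>C x) = x"
      proof (rule eq_by_coefficients)
        fix n
        have "cinner y (\<phi> n) + \<mu> * c n = complex_of_real (l n) * c n"
          using nz[of n] by (simp add: c_def field_simps)
        then show "cinner (S (y + \<mu> *\<^sub>C x)) (\<phi> n) = cinner x (\<phi> n)"
          using l_pos[of n]
          by (simp add: coefficient_S cinner_add_left cinner_scaleC_left
              orthonormal_coefficient[OF orthonormal x])
      qed
      then have "x \<in> D" "T x = y + \<mu> *\<^sub>C x"
        using S_in_D[of "y + \<mu> *\<^sub>C x"] T_S[of "y + \<mu> *\<^sub>C x"] by simp_all
      then show ?thesis
        by (intro image_eqI[of _ _ x]) auto
    qed
    ultimately have bij: "bij_betw ?A D UNIV"
      by (auto simp: bij_betw_def)
    have "norm (inv_into D ?A y) \<le> 1 / d * norm y" for y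
      using bound[of "inv_into D ?A y"] bij
      by (auto simp: bij_betw_def inv_into_into f_inv_into_f[of y ?A D])
    then have "\<mu> \<in> resolvent_set D T"
      using bij linear_operator_inv_into[OF linear_operator_shift bij]
      unfolding resolvent_set_def bounded_operator_def by blast
    with \<open>\<mu> \<in> spectrum D T\<close> show False
      by (simp add: spectrum_def)
  qed
next
  fix \<mu> assume "\<mu> \<in> range (\<lambda>n. complex_of_real (l n))"
  then obtain n where n: "\<mu> = complex_of_real (l n)"
    by blast
  have "\<not> inj_on (\<lambda>x. T x - \<mu> *\<^sub>C x) D"
    using inj_onD[of "\<lambda>x. T x - \<mu> *\<^sub>C x" D "\<phi> n" 0] unit_eigenvectorD(2)[OF eigen, of n]
    by (auto simp: n T_\<phi> \<phi>_in_D)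
  then show "\<mu> \<in> spectrum D T"
    by (auto simp: spectrum_def resolvent_set_def bij_betw_def)
qed

text \<open>\<open>S\<close> divides coefficients by eigenvalues tending to infinity, so on bounded
  sets it is uniformly close to its truncations to finitely many coordinates.\<close>

lemma compact_S: "compact_operator S"
  unfolding compact_operator_def
proof (intro conjI allI impI)
  show "linear_operator UNIV S"
    using inj T_surj by (intro linear_operator_inv_into linear_T) (simp add: bij_betw_def)
  fix A :: "'a set" assume "bounded A"
  then obtain R where R: "R > 0" "\<And>y. y \<in> A \<Longrightarrow> norm y \<le> R"
    by (auto simp: bounded_pos)
  show "compact (closure (S ` A))"
  proof (rule compact_closure_totally_bounded)
    fix e :: real assume "e > 0"
    \<comment> \<open>Chosen so that the discarded tail has norm at most R/K = e/2.\<close>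
    define K where "K = 2 * R / e"
    define F where "F = {n. l n \<le> K}"
    have "K > 0" and fin: "finite F"
      using R(1) \<open>e > 0\<close> finite_l by (auto simp: K_def F_def)
    \<comment> \<open>\<open>l 0\<close> is the smallest eigenvalue, so \<open>R / l 0\<close>
      bounds every coefficient of \<open>S y\<close>.\<close>
    let ?Z = "{\<Sum>i\<in>F. c i *\<^sub>C \<phi> i | c. \<forall>i\<in>F. cmod (c i) \<le> R / l 0}"
    have "compact ?Z"
      by (rule compact_finite_combinations[OF fin])
    then obtain k where k: "finite k" "?Z \<subseteq> (\<Union>x\<in>k. ball x (e/2))"
      using \<open>e > 0\<close> unfolding compact_eq_totally_bounded by (meson half_gt_zero)
    have "\<exists>x\<in>k. S y \<in> ball x e" if "y \<in> A" for y
    proof -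
      define z where "z = (\<Sum>i\<in>F. cinner (S y) (\<phi> i) *\<^sub>C \<phi> i)"
      have "cmod (cinner (S y) (\<phi> i)) \<le> R / l 0" for i
      proof -
        have "cmod (cinner y (\<phi> i)) \<le> R"
          using cauchy_schwarz[of y "\<phi> i"] R(2)[OF that] unit_eigenvectorD(2)[OF eigen, of i] by simp
        then show ?thesis
          using l_pos[of 0] incseqD[OF incseq_l, of 0 i] R(1)
          by (auto simp: coefficient_S norm_divide intro!: frac_le)
      qed
      then have "z \<in> ?Z"
        unfolding z_def mem_Collect_eq by (intro exI[of _ "\<lambda>i. cinner (S y) (\<phi> i)"]) simp
      then obtain x where x: "x \<in> k" "dist x z < e/2"
        using k(2) by auto
      have "norm (S y - z) \<le> 1 / K * norm y"
      proof (rule norm_le_coefficients)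
        fix n
        have z_coeff: "cinner z (\<phi> n) = (if n \<in> F then cinner (S y) (\<phi> n) else 0)"
          unfolding z_def by (rule cinner_orthonormal_sum[OF orthonormal _ fin]) auto
        show "cmod (cinner (S y - z) (\<phi> n)) \<le> 1 / K * cmod (cinner y (\<phi> n))"
        proof (cases "n \<in> F")
          case True
          then show ?thesis
            using \<open>K > 0\<close> by (simp add: cinner_diff_left z_coeff)
        next
          case False
          then have "cmod (cinner y (\<phi> n)) / l n \<le> cmod (cinner y (\<phi> n)) / K"
            using \<open>K > 0\<close> by (intro frac_le) (auto simp: F_def)
          then show ?thesis
            using False l_pos[of n] by (simp add: cinner_diff_left z_coeff coefficient_S norm_divide)
        qed
      qed (use \<open>K > 0\<close> in simp)
      also have "\<dots> \<le> 1 / K * R"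
        using \<open>K > 0\<close> R(2)[OF that] by (intro mult_left_mono) auto
      also have "\<dots> = e / 2"
        using R(1) \<open>e > 0\<close> by (simp add: K_def)
      finally have "dist z (S y) \<le> e / 2"
        by (simp add: dist_norm norm_minus_commute)
      then have "dist x (S y) < e"
        using x(2) dist_triangle[of x "S y" z] by simp
      then show ?thesis
        using x(1) by auto
    qed
    then have "S ` A \<subseteq> (\<Union>x\<in>k. ball x e)"
      by blast
    with k(1) show "\<exists>k. finite k \<and> S ` A \<subseteq> (\<Union>x\<in>k. ball x e)"
      by blast
  qed
qed

lemma closure_span_eigenvectors: "closure (cspan (range \<phi>)) = UNIV"
proof -
  have "x \<in> closure (cspan (range \<phi>))" for x
    unfolding closure_sequential
  proof (intro exI conjI allI)
    show "(\<Sum>k<n. cinner x (\<phi> k) *\<^sub>C \<phi> k) \<in> cspan (range \<phi>)" for n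
      by (intro complex_vector.span_sum complex_vector.span_scale complex_vector.span_base rangeI)
    show "(\<lambda>n. \<Sum>k<n. cinner x (\<phi> k) *\<^sub>C \<phi> k) \<longlonglongrightarrow> x"
      using has_sum_imp_sums[OF expansion] by (simp add: sums_def)
  qed
  then show ?thesis
    by blast
qed

end

text \<open>A finite orthonormal basis would span the space, so infinite dimension makes
  \<open>B\<close> infinite; with finite levels it can then be listed along \<open>nat\<close> by
  increasing eigenvalue.\<close>

lemma (in positive_am_operator) exists_eigenbasis_sequence:
  assumes "\<not> finite_dimensional (UNIV :: 'a set)"
  obtains \<phi> where "eigenbasis_sequence D T \<phi>"
proof -
  obtain B where B: "B \<subseteq> unit_eigenvectors" "orthonormal_on B (\<lambda>x. x)"
    "\<And>y. (\<And>b. b \<in> B \<Longrightarrow> cinner y b = 0) \<Longrightarrow> y = 0"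
    using exists_eigenbasis by blast
  have levels: "finite {b \<in> B. norm (T b) \<le> C}" for C
    using finite_eigenvalue_levels[OF B] .
  have "infinite B"
  proof
    assume "finite B"
    have "x \<in> cspan B" for x
    proof -
      have "x = (\<Sum>b\<in>B. cinner x b *\<^sub>C b)"
        using orthonormal_basis_expansion[OF B(2,3)] has_sum_finite[OF \<open>finite B\<close>] has_sum_unique
        by blast
      also have "\<dots> \<in> cspan B"
        by (intro complex_vector.span_sum complex_vector.span_scale complex_vector.span_base)
      finally show ?thesis .
    qed
    then have "cspan B = UNIV"
      by blast
    with assms \<open>finite B\<close> show False
      by (auto simp: finite_dimensional_def)
  qed
  then obtain \<phi> :: "nat \<Rightarrow> 'a" where \<phi>: "inj \<phi>" "range \<phi> = B" "incseq (\<lambda>n. norm (T (\<phi> n)))"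
    using exists_increasing_enumeration[of B "\<lambda>b. norm (T b)"] levels by blast
  have mem: "\<phi> n \<in> B" for n
    using \<phi>(2) by blast
  have "eigenbasis_sequence D T \<phi>"
  proof unfold_locales
    show "orthonormal_on UNIV \<phi>"
      using orthonormal_onD[OF B(2) mem mem] by (simp add: orthonormal_on_def inj_eq[OF \<phi>(1)])
    show "\<phi> n \<in> unit_eigenvectors" for n
      using mem B(1) by blast
    show "y = 0" if "\<And>n. cinner y (\<phi> n) = 0" for y
      using that \<phi>(2) by (intro B(3)) auto
    show "incseq (\<lambda>n. norm (T (\<phi> n)))"
      by (rule \<phi>(3))
    show "finite {n. norm (T (\<phi> n)) \<le> C}" for C
    proof (rule finite_imageD[OF finite_subset[OF _ levels[of C]]])
      show "\<phi> ` {n. norm (T (\<phi> n)) \<le> C} \<subseteq> {b \<in> B. norm (T b) \<le> C}"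
        using mem by blast
      show "inj_on \<phi> {n. norm (T (\<phi> n)) \<le> C}"
        using \<phi>(1) inj_on_subset by blast
    qed
  qed
  then show ?thesis
    by (rule that)
qed

theorem theorem4p7:
  fixes D :: "'a::complex_hilbert set" and T :: "'a \<Rightarrow> 'a"
  assumes "\<not> finite_dimensional (UNIV :: 'a set)"
    and "densely_defined D"
    and "closed_operator D T"
    and "positive_operator D T"
    and "absolutely_minimum_attaining D T"
    and "\<not> bounded_operator D T"
    and "inj_on T D"
  shows "\<exists>(l :: nat \<Rightarrow> real) (\<phi> :: nat \<Rightarrow> 'a).
    incseq l \<and> \<not> bdd_above (range l) \<and>
    (\<forall>n. eigenvector D T (complex_of_real (l n)) (\<phi> n)) \<and>
    (\<forall>n. card {k. l k = l n} = complex_vector.dim (eigenspace D T (complex_of_real (l n)))) \<and>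
    D = {x. summable (\<lambda>n. (l n)\<^sup>2 * (cmod (cinner x (\<phi> n)))\<^sup>2)} \<and>
    (\<forall>x\<in>D. (\<lambda>n. (complex_of_real (l n) * cinner x (\<phi> n)) *\<^sub>C \<phi> n) sums T x) \<and>
    T ` D = UNIV \<and> compact_operator (inv_into D T) \<and>
    spectrum D T = range (\<lambda>n. complex_of_real (l n)) \<and>
    range (\<lambda>n. complex_of_real (l n)) = point_spectrum D T \<and>
    (\<forall>\<mu>\<in>point_spectrum D T. finite_dimensional (eigenspace D T \<mu>)) \<and>
    closure (cspan (range \<phi>)) = UNIV"
proof -
  interpret positive_am_operator D T
    using assms by unfold_locales
  obtain \<phi> where "eigenbasis_sequence D T \<phi>"
    using exists_eigenbasis_sequence[OF assms(1)] .
  then interpret eigenbasis_sequence D T \<phi> .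
  have "finite_dimensional (eigenspace D T \<mu>)" if \<mu>: "\<mu> \<in> point_spectrum D T" for \<mu>
  proof -
    obtain n where "\<mu> = complex_of_real (l n)"
      using \<mu> unfolding point_spectrum_eq by blast
    then show ?thesis
      using eigenspace_eq_span finite_imageI[OF finite_multiplicity] unfolding finite_dimensional_def
      by blast
  qed
  then show ?thesis
    by (intro exI[of _ l] exI[of _ \<phi>] conjI ballI allI incseq_l l_not_bdd eigenvector_\<phi>
        dim_eigenspace domain_eq T_sums T_surj compact_S spectrum_eq point_spectrum_eq[symmetric]
        closure_span_eigenvectors)
qed

end
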